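(* For any set $\mathcal{D}$, the pre-Lie algebra $(\mathfrak{g}_{\mathcal{PT}(\mathcal{D})},\bullet)$ is freely generated by $\mathrm{Ker}(\delta)$.
   Context: All vector spaces are over a field $\mathbb{K}$ of characteristic zero. A (right) pre-Lie algebra is a vector space with a bilinear product $\bullet$ such that $(x\bullet y)\bullet z-x\bullet(y\bullet z)=(x\bullet z)\bullet y-x\bullet(z\bullet y)$. "Freely generated by the subspace $W$" means that the canonical pre-Lie morphism from the free pre-Lie algebra on the vector space $W$, extending the inclusion of $W$, is an isomorphism. A partitioned forest is a pair $(F,I)$ where $F$ is a rooted forest (edges oriented from the leaves to the roots) and $I$ is a partition of the set of vertices of $F$ such that if two vertices are in the same part of $I$, then either they are both roots, or they have the same direct descendant (i.e. are attached to the same vertex immediately below them). A partitioned tree is a (nonempty) partitioned forest all of whose roots are in the same part; it is decorated by $\mathcal{D}$ if given with a map from its vertices to $\mathcal{D}$. $\mathcal{PT}(\mathcal{D})$ is the set of isoclasses of partitioned trees decorated by $\mathcal{D}$, and $\mathfrak{g}_{\mathcal{PT}(\mathcal{D})}$ is the vector space with basis $\mathcal{PT}(\mathcal{D})$. For $t,t'\in\mathcal{PT}(\mathcal{D})$ and $s$ a vertex of $t$, $t\bullet_st'$ is obtained by grafting all the roots of $t'$ on the vertex $s$ of $t$, the partition being the disjoint union of the partitions of $t$ and $t'$; $t\bullet t'=\sum_{s\in V(t)}t\bullet_st'$, which makes $\mathfrak{g}_{\mathcal{PT}(\mathcal{D})}$ a pre-Lie algebra. For $k\ge1$, $d_1,\ldots,d_k\in\mathcal{D}$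 and finite (possibly empty) multisets $F_i=t_{i,1}\ldots t_{i,n_i}$ of decorated partitioned trees, $B_{d_1,\ldots,d_k}(F_1,\ldots,F_k)$ is the partitioned tree with $k$ roots (all in one part) decorated by $d_1,\ldots,d_k$, obtained by grafting, for each $i$, all the roots of $t_{i,1},\ldots,t_{i,n_i}$ on the $i$-th root, the parts of the partition being the set of the $k$ roots and the parts of all the $t_{i,j}$'s. Every decorated partitioned tree is of this form, uniquely up to a common permutation of the $d_i$'s and $F_i$'s. The linear map $\delta:\mathfrak{g}_{\mathcal{PT}(\mathcal{D})}\to\mathfrak{g}_{\mathcal{PT}(\mathcal{D})}\otimes\mathfrak{g}_{\mathcal{PT}(\mathcal{D})}$ is defined, for $t=B_{d_1,\ldots,d_k}(t_{1,1}\ldots t_{1,n_1},\ldots,t_{k,1}\ldots t_{k,n_k})$, by $$\delta(t)=\frac1k\sum_{i=1}^k\sum_{j=1}^{n_i}B_{d_1,\ldots,d_k}(t_{1,1}\ldots t_{1,n_1},\ldots,t_{i,1}\ldots t_{i,j-1}t_{i,j+1}\ldots t_{i,n_i},\ldots,t_{k,1}\ldots t_{k,n_k})\otimes t_{i,j}.$$ *)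

theory Defs
  imports "HOL-Library.Poly_Mapping" "HOL-Library.Multiset"
begin

section \<open>Pre-Lie algebras\<close>

text \<open>
  The carriers are explicit, since quotients and subspaces depending on a parameter occur below.
  The scalars are the elements of a type of class \<open>field\<close>.
\<close>

record ('k, 'a) vec_struct =
  vcarrier :: "'a set"
  vzero :: 'a
  vadd :: "'a \<Rightarrow> 'a \<Rightarrow> 'a"
  vscale :: "'k \<Rightarrow> 'a \<Rightarrow> 'a"

record ('k, 'a) prelie_struct = "('k, 'a) vec_struct" +
  pmult :: "'a \<Rightarrow> 'a \<Rightarrow> 'a"

locale vec_space =
  fixes V :: "('k::field, 'a, 'm) vec_struct_scheme"
  assumes zero_closed: "vzero V \<in> vcarrier V"
    and add_closed: "\<lbrakk>x \<in> vcarrier V; y \<in> vcarrier V\<rbrakk> \<Longrightarrow> vadd V x y \<in> vcarrier V"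
    and scale_closed: "x \<in> vcarrier V \<Longrightarrow> vscale V c x \<in> vcarrier V"
    and add_assoc: "\<lbrakk>x \<in> vcarrier V; y \<in> vcarrier V; z \<in> vcarrier V\<rbrakk>
      \<Longrightarrow> vadd V (vadd V x y) z = vadd V x (vadd V y z)"
    and add_comm: "\<lbrakk>x \<in> vcarrier V; y \<in> vcarrier V\<rbrakk> \<Longrightarrow> vadd V x y = vadd V y x"
    and add_zero: "x \<in> vcarrier V \<Longrightarrow> vadd V x (vzero V) = x"
    and add_inverse: "x \<in> vcarrier V \<Longrightarrow> vadd V x (vscale V (- 1) x) = vzero V"
    and scale_one: "x \<in> vcarrier V \<Longrightarrow> vscale V 1 x = x"
    and scale_scale: "x \<in> vcarrier V \<Longrightarrow> vscale V c (vscale V d x) = vscale V (c * d) x"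
    and scale_add_right: "\<lbrakk>x \<in> vcarrier V; y \<in> vcarrier V\<rbrakk>
      \<Longrightarrow> vscale V c (vadd V x y) = vadd V (vscale V c x) (vscale V c y)"
    and scale_add_left: "x \<in> vcarrier V
      \<Longrightarrow> vscale V (c + d) x = vadd V (vscale V c x) (vscale V d x)"

locale prelie_algebra = vec_space A
  for A :: "('k::field, 'a, 'm) prelie_struct_scheme" +
  assumes mult_closed: "\<lbrakk>x \<in> vcarrier A; y \<in> vcarrier A\<rbrakk> \<Longrightarrow> pmult A x y \<in> vcarrier A"
    and mult_add_left: "\<lbrakk>x \<in> vcarrier A; y \<in> vcarrier A; z \<in> vcarrier A\<rbrakk>
      \<Longrightarrow> pmult A (vadd A x y) z = vadd A (pmult A x z) (pmult A y z)"
    and mult_add_right: "\<lbrakk>x \<in> vcarrier A; y \<in> vcarrier A; z \<in> vcarrier A\<rbrakk>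
      \<Longrightarrow> pmult A x (vadd A y z) = vadd A (pmult A x y) (pmult A x z)"
    and mult_scale_left: "\<lbrakk>x \<in> vcarrier A; y \<in> vcarrier A\<rbrakk>
      \<Longrightarrow> pmult A (vscale A c x) y = vscale A c (pmult A x y)"
    and mult_scale_right: "\<lbrakk>x \<in> vcarrier A; y \<in> vcarrier A\<rbrakk>
      \<Longrightarrow> pmult A x (vscale A c y) = vscale A c (pmult A x y)"
    and prelie: "\<lbrakk>x \<in> vcarrier A; y \<in> vcarrier A; z \<in> vcarrier A\<rbrakk>
      \<Longrightarrow> vadd A (pmult A (pmult A x y) z) (vscale A (- 1) (pmult A x (pmult A y z)))
        = vadd A (pmult A (pmult A x z) y) (vscale A (- 1) (pmult A x (pmult A z y)))"

definition vec_subspace ::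
    "'a set \<Rightarrow> ('k::field, 'a, 'm) vec_struct_scheme \<Rightarrow> bool" where
  "vec_subspace W V \<longleftrightarrow> W \<subseteq> vcarrier V \<and> vzero V \<in> W
     \<and> (\<forall>x\<in>W. \<forall>y\<in>W. vadd V x y \<in> W) \<and> (\<forall>c. \<forall>x\<in>W. vscale V c x \<in> W)"

definition subspace_struct ::
    "('k, 'a, 'm) vec_struct_scheme \<Rightarrow> 'a set \<Rightarrow> ('k, 'a) vec_struct" where
  "subspace_struct V W =
     \<lparr>vcarrier = W, vzero = vzero V, vadd = vadd V, vscale = vscale V\<rparr>"

definition linear_hom ::
    "('k, 'a, 'm) vec_struct_scheme \<Rightarrow> ('k, 'b, 'n) vec_struct_scheme \<Rightarrow> ('a \<Rightarrow> 'b) \<Rightarrow> bool" where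
  "linear_hom V U f \<longleftrightarrow> (\<forall>x\<in>vcarrier V. f x \<in> vcarrier U)
     \<and> (\<forall>x\<in>vcarrier V. \<forall>y\<in>vcarrier V. f (vadd V x y) = vadd U (f x) (f y))
     \<and> (\<forall>c. \<forall>x\<in>vcarrier V. f (vscale V c x) = vscale U c (f x))"

definition prelie_hom ::
    "('k, 'a, 'm) prelie_struct_scheme \<Rightarrow> ('k, 'b, 'n) prelie_struct_scheme
      \<Rightarrow> ('a \<Rightarrow> 'b) \<Rightarrow> bool" where
  "prelie_hom A B f \<longleftrightarrow> linear_hom A B f
     \<and> (\<forall>x\<in>vcarrier A. \<forall>y\<in>vcarrier A. f (pmult A x y) = pmult B (f x) (f y))"

definition prelie_iso ::
    "('k, 'a, 'm) prelie_struct_scheme \<Rightarrow> ('k, 'b, 'n) prelie_struct_scheme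
      \<Rightarrow> ('a \<Rightarrow> 'b) \<Rightarrow> bool" where
  "prelie_iso A B f \<longleftrightarrow> prelie_hom A B f \<and> bij_betw f (vcarrier A) (vcarrier B)"

section \<open>The free pre-Lie algebra on a vector space\<close>

text \<open>
  The free pre-Lie algebra on a vector space \<open>W\<close> is realized as the quotient of the set of
  formal expressions in the elements of \<open>W\<close> by the congruence generated by the axioms of pre-Lie
  algebras and by the linearity of the inclusion of \<open>W\<close>. The lemmas at the end of this section
  show that it is a pre-Lie algebra and that it has the universal property.
\<close>

datatype ('k, 'a) pterm =
    Gen 'a
  | TZero
  | TAdd "('k, 'a) pterm" "('k, 'a) pterm"
  | TScale 'k "('k, 'a) pterm"
  | TMult "('k, 'a) pterm" "('k, 'a) pterm"

primrec gens :: "('k, 'a) pterm \<Rightarrow> 'a set" where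
  "gens (Gen x) = {x}"
| "gens TZero = {}"
| "gens (TAdd s t) = gens s \<union> gens t"
| "gens (TScale c t) = gens t"
| "gens (TMult s t) = gens s \<union> gens t"

definition pterms :: "('k, 'a, 'm) vec_struct_scheme \<Rightarrow> ('k, 'a) pterm set" where
  "pterms W = {t. gens t \<subseteq> vcarrier W}"

inductive free_eq ::
    "('k::field, 'a, 'm) vec_struct_scheme \<Rightarrow> ('k, 'a) pterm \<Rightarrow> ('k, 'a) pterm \<Rightarrow> bool"
  for W :: "('k::field, 'a, 'm) vec_struct_scheme" where
  refl: "t \<in> pterms W \<Longrightarrow> free_eq W t t"
| sym: "free_eq W s t \<Longrightarrow> free_eq W t s"
| trans: "\<lbrakk>free_eq W s t; free_eq W t u\<rbrakk> \<Longrightarrow> free_eq W s u"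
| cong_add: "\<lbrakk>free_eq W s s'; free_eq W t t'\<rbrakk> \<Longrightarrow> free_eq W (TAdd s t) (TAdd s' t')"
| cong_scale: "free_eq W t t' \<Longrightarrow> free_eq W (TScale c t) (TScale c t')"
| cong_mult: "\<lbrakk>free_eq W s s'; free_eq W t t'\<rbrakk> \<Longrightarrow> free_eq W (TMult s t) (TMult s' t')"
| add_assoc: "\<lbrakk>s \<in> pterms W; t \<in> pterms W; u \<in> pterms W\<rbrakk>
    \<Longrightarrow> free_eq W (TAdd (TAdd s t) u) (TAdd s (TAdd t u))"
| add_comm: "\<lbrakk>s \<in> pterms W; t \<in> pterms W\<rbrakk> \<Longrightarrow> free_eq W (TAdd s t) (TAdd t s)"
| add_zero: "t \<in> pterms W \<Longrightarrow> free_eq W (TAdd t TZero) t"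
| add_inverse: "t \<in> pterms W \<Longrightarrow> free_eq W (TAdd t (TScale (- 1) t)) TZero"
| scale_one: "t \<in> pterms W \<Longrightarrow> free_eq W (TScale 1 t) t"
| scale_scale: "t \<in> pterms W \<Longrightarrow> free_eq W (TScale c (TScale d t)) (TScale (c * d) t)"
| scale_add_right: "\<lbrakk>s \<in> pterms W; t \<in> pterms W\<rbrakk>
    \<Longrightarrow> free_eq W (TScale c (TAdd s t)) (TAdd (TScale c s) (TScale c t))"
| scale_add_left: "t \<in> pterms W
    \<Longrightarrow> free_eq W (TScale (c + d) t) (TAdd (TScale c t) (TScale d t))"
| mult_add_left: "\<lbrakk>s \<in> pterms W; t \<in> pterms W; u \<in> pterms W\<rbrakk>
    \<Longrightarrow> free_eq W (TMult (TAdd s t) u) (TAdd (TMult s u) (TMult t u))"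
| mult_add_right: "\<lbrakk>s \<in> pterms W; t \<in> pterms W; u \<in> pterms W\<rbrakk>
    \<Longrightarrow> free_eq W (TMult s (TAdd t u)) (TAdd (TMult s t) (TMult s u))"
| mult_scale_left: "\<lbrakk>s \<in> pterms W; t \<in> pterms W\<rbrakk>
    \<Longrightarrow> free_eq W (TMult (TScale c s) t) (TScale c (TMult s t))"
| mult_scale_right: "\<lbrakk>s \<in> pterms W; t \<in> pterms W\<rbrakk>
    \<Longrightarrow> free_eq W (TMult s (TScale c t)) (TScale c (TMult s t))"
| prelie: "\<lbrakk>s \<in> pterms W; t \<in> pterms W; u \<in> pterms W\<rbrakk>
    \<Longrightarrow> free_eq W (TAdd (TMult (TMult s t) u) (TScale (- 1) (TMult s (TMult t u))))
                  (TAdd (TMult (TMult s u) t) (TScale (- 1) (TMult s (TMult u t))))"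
| gen_add: "\<lbrakk>x \<in> vcarrier W; y \<in> vcarrier W\<rbrakk>
    \<Longrightarrow> free_eq W (Gen (vadd W x y)) (TAdd (Gen x) (Gen y))"
| gen_scale: "x \<in> vcarrier W \<Longrightarrow> free_eq W (Gen (vscale W c x)) (TScale c (Gen x))"

definition free_class ::
    "('k::field, 'a, 'm) vec_struct_scheme \<Rightarrow> ('k, 'a) pterm \<Rightarrow> ('k, 'a) pterm set" where
  "free_class W t = {s. free_eq W t s}"

definition free_prelie ::
    "('k::field, 'a, 'm) vec_struct_scheme \<Rightarrow> ('k, ('k, 'a) pterm set) prelie_struct" where
  "free_prelie W =
     \<lparr>vcarrier = free_class W ` pterms W,
      vzero = free_class W TZero,
      vadd = (\<lambda>X Y. the_elem {free_class W (TAdd s t) | s t. s \<in> X \<and> t \<in> Y}),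
      vscale = (\<lambda>c X. the_elem {free_class W (TScale c t) | t. t \<in> X}),
      pmult = (\<lambda>X Y. the_elem {free_class W (TMult s t) | s t. s \<in> X \<and> t \<in> Y})\<rparr>"

primrec pterm_eval ::
    "('k, 'b, 'm) prelie_struct_scheme \<Rightarrow> ('a \<Rightarrow> 'b) \<Rightarrow> ('k, 'a) pterm \<Rightarrow> 'b" where
  "pterm_eval A f (Gen x) = f x"
| "pterm_eval A f TZero = vzero A"
| "pterm_eval A f (TAdd s t) = vadd A (pterm_eval A f s) (pterm_eval A f t)"
| "pterm_eval A f (TScale c t) = vscale A c (pterm_eval A f t)"
| "pterm_eval A f (TMult s t) = pmult A (pterm_eval A f s) (pterm_eval A f t)"

text \<open>
  The pre-Lie morphism from \<open>free_prelie W\<close> to \<open>A\<close> extending a linear map \<open>f\<close> from \<open>W\<close> to \<open>A\<close>.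
\<close>

definition free_lift ::
    "('k, 'b, 'm) prelie_struct_scheme \<Rightarrow> ('a \<Rightarrow> 'b) \<Rightarrow> ('k, 'a) pterm set \<Rightarrow> 'b" where
  "free_lift A f X = the_elem (pterm_eval A f ` X)"

definition freely_generated_by ::
    "('k::field, 'a, 'm) prelie_struct_scheme \<Rightarrow> 'a set \<Rightarrow> bool" where
  "freely_generated_by A W \<longleftrightarrow> prelie_algebra A \<and> vec_subspace W A
     \<and> prelie_iso (free_prelie (subspace_struct A W)) A (free_lift A (\<lambda>w. w))"

lemma gens_simps_pterms [simp]:
  "Gen x \<in> pterms W \<longleftrightarrow> x \<in> vcarrier W"
  "TZero \<in> pterms W"
  "TAdd s t \<in> pterms W \<longleftrightarrow> s \<in> pterms W \<and> t \<in> pterms W"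
  "TScale c t \<in> pterms W \<longleftrightarrow> t \<in> pterms W"
  "TMult s t \<in> pterms W \<longleftrightarrow> s \<in> pterms W \<and> t \<in> pterms W"
  by (auto simp: pterms_def)

lemma free_eq_pterms:
  assumes "vec_space W" and "free_eq W s t"
  shows "s \<in> pterms W \<and> t \<in> pterms W"
  using assms(2)
proof induction
  case (gen_add x y)
  then show ?case using vec_space.add_closed[OF assms(1)] by auto
next
  case (gen_scale x c)
  then show ?case using vec_space.scale_closed[OF assms(1)] by auto
qed auto

lemma free_class_eqI:
  assumes "free_eq W s t"
  shows "free_class W s = free_class W t"
proof -
  have "free_eq W s u \<longleftrightarrow> free_eq W t u" for u
    using free_eq.trans[OF assms] free_eq.trans[OF free_eq.sym[OF assms]] by blast
  then show ?thesis
    by (simp add: free_class_def)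
qed

lemma free_class_eq_iff:
  assumes "t \<in> pterms W"
  shows "free_class W s = free_class W t \<longleftrightarrow> free_eq W s t"
proof
  assume "free_class W s = free_class W t"
  with free_eq.refl[OF assms] show "free_eq W s t"
    by (auto simp: free_class_def)
qed (rule free_class_eqI)

lemma free_prelie_simps:
  "vcarrier (free_prelie W) = free_class W ` pterms W"
  "vzero (free_prelie W) = free_class W TZero"
  by (simp_all add: free_prelie_def)

lemma free_prelie_ops:
  assumes "s \<in> pterms W" "t \<in> pterms W"
  shows "vadd (free_prelie W) (free_class W s) (free_class W t) = free_class W (TAdd s t)"
    and "pmult (free_prelie W) (free_class W s) (free_class W t) = free_class W (TMult s t)"
proof -
  have r: "s \<in> free_class W s" "t \<in> free_class W t"
    using assms by (auto simp: free_class_def intro: free_eq.refl)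
  have c: "free_class W (TAdd s' t') = free_class W (TAdd s t)"
    "free_class W (TMult s' t') = free_class W (TMult s t)"
    if "s' \<in> free_class W s" "t' \<in> free_class W t" for s' t'
    using that by (simp_all add: free_class_def[of W s] free_class_def[of W t]
        free_class_eqI[symmetric] free_eq.cong_add free_eq.cong_mult)
  have "{free_class W (TAdd s' t') | s' t'. s' \<in> free_class W s \<and> t' \<in> free_class W t}
      = {free_class W (TAdd s t)}"
    using r c(1) by blast
  then show "vadd (free_prelie W) (free_class W s) (free_class W t) = free_class W (TAdd s t)"
    by (simp add: free_prelie_def)
  have "{free_class W (TMult s' t') | s' t'. s' \<in> free_class W s \<and> t' \<in> free_class W t}
      = {free_class W (TMult s t)}"
    using r c(2) by blast
  then show "pmult (free_prelie W) (free_class W s) (free_class W t) = free_class W (TMult s t)"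
    by (simp add: free_prelie_def)
qed

lemma free_prelie_scale:
  assumes "t \<in> pterms W"
  shows "vscale (free_prelie W) c (free_class W t) = free_class W (TScale c t)"
proof -
  have "t \<in> free_class W t"
    using assms by (auto simp: free_class_def intro: free_eq.refl)
  moreover have "free_class W (TScale c t') = free_class W (TScale c t)"
    if "t' \<in> free_class W t" for t'
    using that
    by (simp add: free_class_def[of W t] free_class_eqI[symmetric] free_eq.cong_scale)
  ultimately have
    "{free_class W (TScale c t') | t'. t' \<in> free_class W t} = {free_class W (TScale c t)}"
    by blast
  then show ?thesis
    by (simp add: free_prelie_def)
qed

theorem prelie_algebra_free_prelie:
  fixes W :: "('k::field, 'a, 'm) vec_struct_scheme"
  shows "prelie_algebra (free_prelie W)"
  by unfold_locales
    (simp only: free_prelie_simps, (elim imageE)?,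
      simp add: free_prelie_ops free_prelie_scale free_class_eq_iff imageI free_eq.intros(7-19))+

lemma pterm_eval_closed:
  assumes "prelie_algebra A" "linear_hom W A f" "t \<in> pterms W"
  shows "pterm_eval A f t \<in> vcarrier A"
proof -
  interpret prelie_algebra A by fact
  show ?thesis using assms(2,3)
    by (induction t) (auto simp: linear_hom_def zero_closed add_closed scale_closed mult_closed)
qed

lemma pterm_eval_free_eq:
  assumes "vec_space W" "prelie_algebra A" "linear_hom W A f" "free_eq W s t"
  shows "pterm_eval A f s = pterm_eval A f t"
proof -
  interpret prelie_algebra A by fact
  note cl = pterm_eval_closed[OF assms(2,3)]
  show ?thesis using assms(4)
  proof induction
    case (gen_add x y)
    then show ?case using assms(3) by (simp add: linear_hom_def)
  next
    case (gen_scale x c)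
    then show ?case using assms(3) by (simp add: linear_hom_def)
  next
    case (prelie s t u)
    then show ?case using prelie_algebra.prelie[OF assms(2)] by (simp add: cl)
  qed (simp_all add: cl add_assoc add_comm add_zero add_inverse scale_one scale_scale
        scale_add_right scale_add_left mult_add_left mult_add_right mult_scale_left
        mult_scale_right)
qed

lemma free_lift_class:
  assumes "vec_space W" "prelie_algebra A" "linear_hom W A f" "t \<in> pterms W"
  shows "free_lift A f (free_class W t) = pterm_eval A f t"
proof -
  have "t \<in> free_class W t"
    using free_eq.refl[OF assms(4)] by (simp add: free_class_def)
  moreover have "pterm_eval A f s = pterm_eval A f t" if "s \<in> free_class W t" for s
    using pterm_eval_free_eq[OF assms(1-3), of t s] that by (simp add: free_class_def)
  ultimately have "pterm_eval A f ` free_class W t = {pterm_eval A f t}"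
    by blast
  then show ?thesis by (simp add: free_lift_def)
qed

theorem free_prelie_universal:
  assumes "vec_space W" "prelie_algebra A" "linear_hom W A f"
  shows "linear_hom W (free_prelie W) (\<lambda>x. free_class W (Gen x))"
    and "prelie_hom (free_prelie W) A (free_lift A f)"
    and "\<And>x. x \<in> vcarrier W \<Longrightarrow> free_lift A f (free_class W (Gen x)) = f x"
    and "\<And>g X. \<lbrakk>prelie_hom (free_prelie W) A g;
           \<And>x. x \<in> vcarrier W \<Longrightarrow> g (free_class W (Gen x)) = f x;
           X \<in> vcarrier (free_prelie W)\<rbrakk> \<Longrightarrow> g X = free_lift A f X"
proof -
  interpret W: vec_space W by fact
  interpret prelie_algebra A by fact
  note lc = free_lift_class[OF assms]
  show "linear_hom W (free_prelie W) (\<lambda>x. free_class W (Gen x))"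
    by (simp add: linear_hom_def free_prelie_simps free_prelie_ops free_prelie_scale
        free_class_eq_iff
        W.add_closed W.scale_closed free_eq.gen_add free_eq.gen_scale)
  show "prelie_hom (free_prelie W) A (free_lift A f)"
    by (auto simp: prelie_hom_def linear_hom_def free_prelie_simps free_prelie_ops free_prelie_scale
        lc
        intro: pterm_eval_closed[OF assms(2,3)])
  show "\<And>x. x \<in> vcarrier W \<Longrightarrow> free_lift A f (free_class W (Gen x)) = f x"
    by (simp add: lc)
  fix g X
  assume g: "prelie_hom (free_prelie W) A g"
    and ext: "\<And>x. x \<in> vcarrier W \<Longrightarrow> g (free_class W (Gen x)) = f x"
    and X: "X \<in> vcarrier (free_prelie W)"
  have add: "g (free_class W (TAdd s t)) = vadd A (g (free_class W s)) (g (free_class W t))"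
    and mul: "g (free_class W (TMult s t)) = pmult A (g (free_class W s)) (g (free_class W t))"
    and scl: "g (free_class W (TScale c t)) = vscale A c (g (free_class W t))"
    if "s \<in> pterms W" "t \<in> pterms W" for s t c
    unfolding free_prelie_ops[OF that, symmetric] free_prelie_scale[OF that(2), symmetric]
    using g that by (simp_all add: prelie_hom_def linear_hom_def free_prelie_simps)
  have zero: "g (free_class W TZero) = vzero A"
  proof -
    have "g (free_class W TZero) = g (free_class W (TAdd TZero (TScale (- 1) TZero)))"
      using free_class_eqI[OF free_eq.add_inverse[of TZero W]] by simp
    also have "\<dots> = vadd A (g (free_class W TZero)) (vscale A (- 1) (g (free_class W TZero)))"
      using add[of TZero "TScale (- 1) TZero"] scl[of TZero TZero "- 1"] by simp
    also have "\<dots> = vzero A"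
      using g by (intro add_inverse) (auto simp: prelie_hom_def linear_hom_def free_prelie_simps)
    finally show ?thesis .
  qed
  have "g (free_class W t) = pterm_eval A f t" if "t \<in> pterms W" for t
    using that by (induction t) (auto simp: ext zero add mul scl)
  then show "g X = free_lift A f X"
    using X by (auto simp: free_prelie_simps lc)
qed

section \<open>Partitioned trees\<close>

text \<open>
  Isoclasses of decorated partitioned trees. \<open>B M\<close> is the tree with one root for each element
  \<open>(d, F)\<close> of the multiset \<open>M\<close>: this root is decorated by \<open>d\<close>, and the multiset \<open>F\<close> consists of
  the partitioned trees grafted on it, one for each part of the set of its direct ascendants.
  So \<open>B\<^bsub>d\<^sub>1,\<dots>,d\<^sub>k\<^esub>(F\<^sub>1,\<dots>,F\<^sub>k)\<close> is \<open>B {#(d\<^sub>1, F\<^sub>1), \<dots>, (d\<^sub>k, F\<^sub>k)#}\<close>. The datatype also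
  contains trees with an empty set of roots; these are excluded by \<open>PT\<close>.
\<close>

datatype 'd ptree = B "('d \<times> 'd ptree multiset) multiset"

inductive_set PT :: "'d set \<Rightarrow> 'd ptree set" for D :: "'d set" where
  "\<lbrakk>M \<noteq> {#}; \<forall>(d, F) \<in> set_mset M. d \<in> D \<and> (\<forall>t \<in> set_mset F. t \<in> PT D)\<rbrakk> \<Longrightarrow> B M \<in> PT D"
monos split_beta

lemma le_size_multiset:
  assumes "x \<in># M"
  shows "f x \<le> size_multiset f M"
  using assms by (auto dest!: multi_member_split)

lemma size_subtree:
  assumes "(d, F) \<in># M" and "t \<in># F"
  shows "size t < size (B M)"
proof -
  have "size t \<le> size_multiset size F"
    using assms(2) by (rule le_size_multiset)
  also have "\<dots> \<le> size_prod (\<lambda>_. 0) (size_multiset size) (d, F)"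
    by simp
  also have "\<dots> \<le> size_multiset (size_prod (\<lambda>_. 0) (size_multiset size)) M"
    using assms(1) by (rule le_size_multiset)
  finally show ?thesis by simp
qed

declare image_mset_cong [fundef_cong]

text \<open>
  \<open>graft t t'\<close> is the multiset of the trees obtained by grafting all the roots of \<open>t'\<close>, which
  remain a part of the partition, on \<open>s\<close>, where \<open>s\<close> runs over the vertices of \<open>t\<close>. In the
  recursive equation, \<open>s\<close> is either the root \<open>(d, F)\<close>, or a vertex of one of the trees in \<open>F\<close>.
\<close>

function graft :: "'d ptree \<Rightarrow> 'd ptree \<Rightarrow> 'd ptree multiset" where
  "graft (B M) t' = (\<Sum>(d, F)\<in>#M.
      {#B (M - {#(d, F)#} + {#(d, F + {#t'#})#})#}
      + (\<Sum>t\<in>#F. {#B (M - {#(d, F)#} + {#(d, F - {#t#} + {#u#})#}). u \<in># graft t t'#}))"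
  by pat_completeness auto
termination
  by (relation "measure (size \<circ> fst)") (simp, simp only: in_measure o_apply fst_conv, metis size_subtree)

section \<open>The pre-Lie algebra of partitioned trees and the map delta\<close>

text \<open>
  The vector space with basis \<open>X\<close> consists of the finitely supported functions with support
  in \<open>X\<close>.
\<close>

definition scale :: "'k::field \<Rightarrow> ('a \<Rightarrow>\<^sub>0 'k) \<Rightarrow> 'a \<Rightarrow>\<^sub>0 'k" where
  "scale c x = Poly_Mapping.map ((*) c) x"

definition lin_ext :: "('a \<Rightarrow> 'b \<Rightarrow>\<^sub>0 'k) \<Rightarrow> ('a \<Rightarrow>\<^sub>0 'k::field) \<Rightarrow> 'b \<Rightarrow>\<^sub>0 'k" where
  "lin_ext f x = (\<Sum>a\<in>Poly_Mapping.keys x. scale (Poly_Mapping.lookup x a) (f a))"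

definition ptree_mult ::
    "('d ptree \<Rightarrow>\<^sub>0 'k::field) \<Rightarrow> ('d ptree \<Rightarrow>\<^sub>0 'k) \<Rightarrow> 'd ptree \<Rightarrow>\<^sub>0 'k" where
  "ptree_mult x y =
     lin_ext (\<lambda>t. lin_ext (\<lambda>t'. \<Sum>u\<in>#graft t t'. Poly_Mapping.single u 1) y) x"

definition g_PT :: "'d set \<Rightarrow> ('k::field, 'd ptree \<Rightarrow>\<^sub>0 'k) prelie_struct" where
  "g_PT D =
     \<lparr>vcarrier = {x. Poly_Mapping.keys x \<subseteq> PT D},
      vzero = 0, vadd = (+), vscale = scale, pmult = ptree_mult\<rparr>"

text \<open>
  The tensor square of the space with basis \<open>X\<close> is identified with the space with basis
  \<open>X \<times> X\<close>, so that \<open>t \<otimes> t'\<close> is the basis element \<open>(t, t')\<close>.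
\<close>

primrec delta_ptree :: "'d ptree \<Rightarrow> ('d ptree \<times> 'd ptree) \<Rightarrow>\<^sub>0 'k::field" where
  "delta_ptree (B M) = scale (1 / of_nat (size M))
     (\<Sum>(d, F)\<in>#M. \<Sum>t\<in>#F.
        Poly_Mapping.single (B (M - {#(d, F)#} + {#(d, F - {#t#})#}), t) 1)"

definition delta :: "('d ptree \<Rightarrow>\<^sub>0 'k::field) \<Rightarrow> ('d ptree \<times> 'd ptree) \<Rightarrow>\<^sub>0 'k" where
  "delta = lin_ext delta_ptree"

definition ker_delta :: "'d set \<Rightarrow> ('d ptree \<Rightarrow>\<^sub>0 'k::field) set" where
  "ker_delta D = {x \<in> vcarrier (g_PT D). delta x = 0}"

end

(*
  Write \<delta>(x) = \<Sum> x' \<otimes> x''. Then \<delta>(x \<bullet> y) = x \<otimes> y + \<Sum> (x' \<bullet> y) \<otimes> x'' + \<Sum> x' \<otimes> (x'' \<bullet> y),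
  and (\<delta> \<otimes> id) \<circ> \<delta> is symmetric in its last two factors. Consider nu(x) = \<Sum> x' \<bullet> x''. If applying
  \<delta> to the left factor n + 1 times kills x, then applying it n times kills nu(x) - n x. As
  the characteristic is zero, the algebra is the direct sum of Ker \<delta> = Ker nu and of the
  image of nu, degree by degree. In particular Ker \<delta> generates. A linear inverse f of the
  canonical morphism from the free algebra is defined by recursion on the degree: it is the
  inclusion on Ker \<delta>, and f(nu(z)) = \<Sum> f(z') f(z''). Computing f(nu(x \<bullet> y)) in two ways and
  using the pre-Lie identity, one finds by induction that h(x) = f(x \<bullet> y) - f(x) f(y) vanishes
  on all x + nu(x), hence everywhere, since 1 + nu is invertible.
*)

theory Submission
  imports Defs "HOL.Vector_Spaces"
begin

section \<open>Grafting and pruning\<close>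

text \<open>Handing \<open>h\<close> the rest of the multiset makes \<open>pick_add\<close> a
  recursion free of multiset subtraction. With values in any commutative monoid, the same rules
  serve for multisets of trees and for vectors.\<close>

definition pick :: "'a multiset \<Rightarrow> ('a \<Rightarrow> 'a multiset \<Rightarrow> 'b::comm_monoid_add) \<Rightarrow> 'b" where
  "pick M h = (\<Sum>x\<in>#M. h x (M - {#x#}))"

lemma pick_empty [simp]: "pick {#} h = 0"
  by (simp add: pick_def)

lemma pick_cong [fundef_cong]:
  assumes "M = M'" and "\<And>x N. M' = add_mset x N \<Longrightarrow> h x N = h' x N"
  shows "pick M h = pick M' h'"
  unfolding pick_def assms(1)
  by (rule arg_cong[of _ _ sum_mset], rule image_mset_cong, rule assms(2)) simp

lemma pick_add [simp]:
  "pick (add_mset x M) h = h x M + pick M (\<lambda>y N. h y (add_mset x N))"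
proof -
  have "(\<Sum>y\<in>#M. h y (add_mset x M - {#y#})) = (\<Sum>y\<in>#M. h y (add_mset x (M - {#y#})))"
    by (rule arg_cong[of _ _ sum_mset], rule image_mset_cong) simp
  then show ?thesis by (simp add: pick_def)
qed

lemma pick_distrib: "pick M (\<lambda>x N. h x N + k x N) = pick M h + pick M k"
  by (simp add: pick_def sum_mset.distrib)

lemma pick_sum_mset: "pick M (\<lambda>x N. \<Sum>u\<in>#A. h x N u) = (\<Sum>u\<in>#A. pick M (\<lambda>x N. h x N u))"
  unfolding pick_def by (rule sum_mset.swap)

lemma pick_swap:
  "pick M (\<lambda>x N. pick L (\<lambda>y P. h x N y P)) = pick L (\<lambda>y P. pick M (\<lambda>x N. h x N y P))"
  unfolding pick_def by (rule sum_mset.swap)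

text \<open>Both sides sum over ordered pairs of distinct occurrences. In the induction the new
  element contributes once as first and once as second entry, and these two contributions trade
  places.\<close>

lemma pick_pick_commute:
  "pick M (\<lambda>x N. pick N (\<lambda>y P. h x y P)) = pick M (\<lambda>x N. pick N (\<lambda>y P. h y x P))"
proof (induction M arbitrary: h)
  case (add z M)
  show ?case
    using add[of "\<lambda>x y P. h x y (add_mset z P)"]
    by (simp add: pick_distrib ac_simps)
qed simp

text \<open>Acting with \<open>f\<close> and then with \<open>g\<close> on one element of a multiset each: either both hit the
  same element, or two different ones.\<close>

lemma pick_act_act:
  fixes g :: "'a \<Rightarrow> 'c multiset"
  shows "pick M (\<lambda>x N. \<Sum>y\<in>#f x. pick (add_mset y N) (\<lambda>w P. \<Sum>v\<in>#g w. h v P))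
    = pick M (\<lambda>x N. \<Sum>y\<in>#f x. \<Sum>v\<in>#g y. h v N)
      + pick M (\<lambda>x N. pick N (\<lambda>w P. \<Sum>y\<in>#f x. \<Sum>v\<in>#g w. h v (add_mset y P)))"
  by (simp add: sum_mset.distrib pick_distrib pick_sum_mset[symmetric])

section \<open>Grafting and the pre-Lie identity on trees\<close>

definition graft_at :: "'d ptree \<Rightarrow> 'd \<times> 'd ptree multiset \<Rightarrow> ('d \<times> 'd ptree multiset) multiset" where
  "graft_at y x = {#(fst x, add_mset y (snd x))#}
     + pick (snd x) (\<lambda>t G. {#(fst x, add_mset u G). u \<in># graft t y#})"

lemma sum_mset_sum_mset: "(\<Sum>x\<in>#(\<Sum>a\<in>#A. f a). h x) = (\<Sum>a\<in>#A. \<Sum>x\<in>#f a. h x)"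
  by (induction A) auto

lemma sum_mset_pick: "(\<Sum>x\<in>#pick M f. h x) = pick M (\<lambda>y N. \<Sum>x\<in>#f y N. h x)"
  by (simp add: pick_def sum_mset_sum_mset)

lemma sum_mset_image: "(\<Sum>x\<in>#image_mset f A. h x) = (\<Sum>a\<in>#A. h (f a))"
  by (simp add: image_mset.compositionality o_def)

lemma sum_graft_at: "(\<Sum>v\<in>#graft_at y x. h v)
   = h (fst x, add_mset y (snd x))
     + pick (snd x) (\<lambda>t G. \<Sum>u\<in>#graft t y. h (fst x, add_mset u G))"
  by (simp add: graft_at_def sum_mset_pick sum_mset_image)

lemma image_mset_sum_mset: "image_mset f (\<Sum>a\<in>#A. g a) = (\<Sum>a\<in>#A. image_mset f (g a))"
  by (induction A) auto

text \<open>Moves the recursion of \<open>graft\<close> into \<open>graft_at\<close>, which treats a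
  single root with the trees above it. The pre-Lie identity can then be proved first for one root
  and then for the multiset of roots.\<close>

lemma graft_B: "graft (B M) y = pick M (\<lambda>x N. {#B (add_mset v N). v \<in># graft_at y x#})"
  by (simp add: graft_at_def pick_def case_prod_unfold graft.simps image_mset.compositionality o_def
    image_mset_sum_mset)

declare graft.simps [simp del]

lemma sum_graft_B: "(\<Sum>u\<in>#graft (B M) y. h u)
    = pick M (\<lambda>x N. \<Sum>v\<in>#graft_at y x. h (B (add_mset v N)))"
  by (simp add: graft_B sum_mset_pick sum_mset_image)

lemma pick_pick_act_commute:
  "pick M (\<lambda>x N. pick N (\<lambda>w P. \<Sum>y\<in>#f x. \<Sum>v\<in>#g w. h (add_mset v (add_mset y P))))
    = pick M (\<lambda>x N. pick N (\<lambda>w P. \<Sum>y\<in>#g x. \<Sum>v\<in>#f w. h (add_mset v (add_mset y P))))"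
proof -
  have "(\<Sum>y\<in>#f x. \<Sum>v\<in>#g w. h (add_mset v (add_mset y P)))
      = (\<Sum>y\<in>#g w. \<Sum>v\<in>#f x. h (add_mset v (add_mset y P)))" for x w P
    by (subst sum_mset.swap) (simp add: add_mset_commute)
  then show ?thesis
    by (subst pick_pick_commute) simp
qed

text \<open>The identity is written without subtraction because the values lie in a monoid. The
  hypothesis is the identity for the trees on the root; the pairs of graftings are sorted by where
  \<open>y\<close> and \<open>z\<close> land.\<close>

lemma graft_at_prelie:
  fixes h :: "_ \<Rightarrow> 'b::comm_monoid_add"
  assumes "\<And>t y z (h :: _ \<Rightarrow> 'b). t \<in># snd x \<Longrightarrow>
      (\<Sum>u\<in>#graft t y. \<Sum>v\<in>#graft u z. h v) + (\<Sum>w\<in>#graft z y. \<Sum>u\<in>#graft t w. h u)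
    = (\<Sum>u\<in>#graft t z. \<Sum>v\<in>#graft u y. h v) + (\<Sum>w\<in>#graft y z. \<Sum>u\<in>#graft t w. h u)"
  shows "(\<Sum>u\<in>#graft_at y x. \<Sum>v\<in>#graft_at z u. h v) + (\<Sum>w\<in>#graft z y. \<Sum>u\<in>#graft_at w x. h u)
    = (\<Sum>u\<in>#graft_at z x. \<Sum>v\<in>#graft_at y u. h v) + (\<Sum>w\<in>#graft y z. \<Sum>u\<in>#graft_at w x. h u)"
proof -
  obtain d F where x: "x = (d, F)" by fastforce
  define k where "k G = h (d, G)" for G
  \<comment> \<open>\<open>X\<close>: into two different trees. \<open>Y\<close>: the first argument
    on the root, the second into a tree. \<open>Z\<close>: both in succession into the same tree, or
    one grafted on the other and the result into a tree. All remaining terms involve only the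
    root.\<close>
  define X where "X y z = pick F (\<lambda>t G. pick G (\<lambda>s P. \<Sum>u\<in>#graft t y. \<Sum>v\<in>#graft s z.
      k (add_mset v (add_mset u P))))" for y z
  define Y where "Y y z = pick F (\<lambda>s G. \<Sum>v\<in>#graft s z. k (add_mset v (add_mset y G)))" for y z
  define Z where "Z y z = pick F (\<lambda>t G. (\<Sum>u\<in>#graft t y. \<Sum>v\<in>#graft u z. k (add_mset v G))
     + (\<Sum>w\<in>#graft z y. \<Sum>u\<in>#graft t w. k (add_mset u G)))" for y z
  have expand: "(\<Sum>u\<in>#graft_at y x. \<Sum>v\<in>#graft_at z u. h v)
      + (\<Sum>w\<in>#graft z y. \<Sum>u\<in>#graft_at w x. h u)
    = k (add_mset z (add_mset y F))
      + ((\<Sum>v\<in>#graft y z. k (add_mset v F)) + (\<Sum>v\<in>#graft z y. k (add_mset v F)))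
      + (Y y z + Y z y) + X y z + Z y z" for y z
    by (simp add: x sum_graft_at sum_mset.distrib pick_distrib X_def Y_def Z_def k_def
        pick_act_act[where h = "\<lambda>v N. h (d, add_mset v N)"] pick_sum_mset add_mset_commute ac_simps)
  have "X y z = X z y"
    unfolding X_def by (rule pick_pick_act_commute)
  moreover have "Z y z = Z z y"
    unfolding Z_def by (rule pick_cong) (auto simp: assms x)
  ultimately show ?thesis
    unfolding expand by (simp add: add_mset_commute ac_simps)
qed

text \<open>The scheme of \<open>graft_at_prelie\<close> one level up: graftings at two different
  roots (\<open>X\<close>) commute, and those at one root (\<open>Z\<close>) are covered by
  \<open>graft_at_prelie\<close>, whose hypothesis is the induction hypothesis.\<close>

lemma graft_prelie:
  fixes h :: "_ \<Rightarrow> 'b::comm_monoid_add"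
  shows "(\<Sum>u\<in>#graft t y. \<Sum>v\<in>#graft u z. h v) + (\<Sum>w\<in>#graft z y. \<Sum>u\<in>#graft t w. h u)
    = (\<Sum>u\<in>#graft t z. \<Sum>v\<in>#graft u y. h v) + (\<Sum>w\<in>#graft y z. \<Sum>u\<in>#graft t w. h u)"
proof (induction t arbitrary: y z h)
  case (B M)
  define X where "X y z = pick M (\<lambda>x N. pick N (\<lambda>w P. \<Sum>u\<in>#graft_at y x. \<Sum>v\<in>#graft_at z w.
      h (B (add_mset v (add_mset u P)))))" for y z
  define Z where "Z y z = pick M (\<lambda>x N.
      (\<Sum>u\<in>#graft_at y x. \<Sum>v\<in>#graft_at z u. h (B (add_mset v N)))
     + (\<Sum>w\<in>#graft z y. \<Sum>u\<in>#graft_at w x. h (B (add_mset u N))))" for y z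
  have expand: "(\<Sum>u\<in>#graft (B M) y. \<Sum>v\<in>#graft u z. h v)
      + (\<Sum>w\<in>#graft z y. \<Sum>u\<in>#graft (B M) w. h u) = X y z + Z y z" for y z
    by (simp add: sum_graft_B pick_act_act[where h = "\<lambda>v N. h (B (add_mset v N))"] X_def
        Z_def pick_sum_mset pick_distrib ac_simps del: pick_add)
  have "X y z = X z y"
    unfolding X_def by (rule pick_pick_act_commute)
  moreover have "Z y z = Z z y"
    unfolding Z_def
  proof (rule pick_cong[OF HOL.refl])
    fix x N assume M: "M = add_mset x N"
    show "(\<Sum>u\<in>#graft_at y x. \<Sum>v\<in>#graft_at z u. h (B (add_mset v N)))
       + (\<Sum>w\<in>#graft z y. \<Sum>u\<in>#graft_at w x. h (B (add_mset u N)))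
       = (\<Sum>u\<in>#graft_at z x. \<Sum>v\<in>#graft_at y u. h (B (add_mset v N)))
       + (\<Sum>w\<in>#graft y z. \<Sum>u\<in>#graft_at w x. h (B (add_mset u N)))"
      by (rule graft_at_prelie, rule B.IH[of x "snd x"]) (auto simp: M snds.simps)
  qed
  ultimately show ?case unfolding expand by simp
qed

section \<open>Pruning and its interplay with grafting\<close>

primrec roots :: "'d ptree \<Rightarrow> ('d \<times> 'd ptree multiset) multiset" where
  "roots (B M) = M"

text \<open>The terms of \<open>\<delta>\<close>, without the factor \<open>1/k\<close>.\<close>

definition prunings :: "'d ptree \<Rightarrow> ('d ptree \<times> 'd ptree) multiset" where
  "prunings t = pick (roots t)
     (\<lambda>x N. pick (snd x) (\<lambda>t G. {#(B (add_mset (fst x, G) N), t)#}))"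

abbreviation prune_sum :: "'d ptree \<Rightarrow> ('d ptree \<Rightarrow> 'd ptree \<Rightarrow> 'b::comm_monoid_add) \<Rightarrow> 'b" where
  "prune_sum t h \<equiv> (\<Sum>p\<in>#prunings t. h (fst p) (snd p))"

lemma prune_sum_B: "(\<Sum>p\<in>#prunings (B M). h p) =
     pick M (\<lambda>x N. pick (snd x) (\<lambda>t G. h (B (add_mset (fst x, G) N), t)))"
  by (simp add: prunings_def sum_mset_pick)

text \<open>Two successive cuts remove an ordered pair of distinct trees, taken from the same root
  or from two different roots; what remains does not depend on the order.\<close>

lemma prune_prune_commute:
  "prune_sum t (\<lambda>a b. prune_sum a (\<lambda>c e. g c e b)) = prune_sum t (\<lambda>a b. prune_sum a (\<lambda>c e. g c b e))"
proof (cases t)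
  case (B M)
  have "pick M (\<lambda>x N. pick (snd x) (\<lambda>b G. pick G (\<lambda>e G'. g (B (add_mset (fst x, G') N)) e b)))
    = pick M (\<lambda>x N. pick (snd x) (\<lambda>b G. pick G (\<lambda>e G'. g (B (add_mset (fst x, G') N)) b e)))"
    by (rule pick_cong[OF HOL.refl], rule pick_pick_commute)
  moreover have "pick M (\<lambda>x N. pick (snd x) (\<lambda>b G. pick N (\<lambda>w P. pick (snd w) (\<lambda>e G'.
      g (B (add_mset (fst w, G') (add_mset (fst x, G) P))) e b))))
    = pick M (\<lambda>x N. pick (snd x) (\<lambda>b G. pick N (\<lambda>w P. pick (snd w) (\<lambda>e G'.
      g (B (add_mset (fst w, G') (add_mset (fst x, G) P))) b e))))"
    apply (subst (1 2) pick_swap)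
    apply (subst pick_pick_commute)
    apply (subst pick_swap)
    apply (simp add: add_mset_commute)
    done
  ultimately show ?thesis by (simp add: B prune_sum_B pick_distrib)
qed

text \<open>A cut after grafting \<open>y\<close> can remove \<open>y\<close> itself, if it sits on
  a root; this gives \<open>(t, y)\<close> once for each root. Otherwise it removes a tree of
  \<open>t\<close>, and \<open>y\<close> was grafted either into that tree or into what
  remains.\<close>

lemma prune_graft:
  fixes h :: "_ \<Rightarrow> _ \<Rightarrow> 'b::comm_monoid_add"
  shows "(\<Sum>u\<in>#graft t y. prune_sum u h)
    = (\<Sum>i\<in>#roots t. h t y)
      + prune_sum t (\<lambda>a b. (\<Sum>u\<in>#graft a y. h u b) + (\<Sum>u\<in>#graft b y. h a u))"
proof (cases t)
  case (B M)
  define k where "k d N G b = h (B (add_mset (d, G) N)) b" for d N G b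
  have roots: "pick M (\<lambda>x N. h (B (add_mset x N)) y) = (\<Sum>i\<in>#M. h (B M) y)"
    unfolding pick_def by (rule arg_cong[of _ _ sum_mset], rule image_mset_cong) simp
  \<comment> \<open>\<open>X1\<close>, \<open>X2\<close>: \<open>y\<close> is grafted at or above
    one root and the cut is at another. \<open>Y1\<close>, \<open>Y2\<close>: \<open>y\<close>
    enters a tree and another tree of the same root is cut. \<open>Z\<close>: \<open>y\<close> sits
    directly on the root that loses a tree. \<open>T\<close>: \<open>y\<close> is inside the cut
    tree.\<close>
  define X1 where "X1 = pick M (\<lambda>x N. pick N (\<lambda>w P. \<Sum>v\<in>#graft_at y x. pick (snd w)
     (\<lambda>b G. h (B (add_mset (fst w, G) (add_mset v P))) b)))"
  define X2 where "X2 = pick M (\<lambda>x N. pick (snd x) (\<lambda>b G. pick N (\<lambda>w P. \<Sum>v\<in>#graft_at y w.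
     h (B (add_mset v (add_mset (fst x, G) P))) b)))"
  have "X2 = pick M (\<lambda>x N. pick N (\<lambda>w P. pick (snd x) (\<lambda>b G. \<Sum>v\<in>#graft_at y w.
     h (B (add_mset v (add_mset (fst x, G) P))) b)))"
    unfolding X2_def by (rule pick_cong[OF HOL.refl], rule pick_swap)
  then have X: "X1 = X2"
    unfolding X1_def
    by (subst pick_pick_commute) (simp add: pick_sum_mset add_mset_commute)
  define Y1 where "Y1 x N = pick (snd x) (\<lambda>b G. \<Sum>u\<in>#graft b y. pick G (\<lambda>c G'.
     h (B (add_mset (fst x, add_mset u G') N)) c))" for x N
  define Y2 where "Y2 x N = pick (snd x) (\<lambda>c G. pick G (\<lambda>b G'. \<Sum>u\<in>#graft b y.
     h (B (add_mset (fst x, add_mset u G') N)) c))" for x N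
  have Y: "Y1 x N = Y2 x N" for x N
    unfolding Y1_def Y2_def by (subst pick_pick_commute) (simp add: pick_sum_mset)
  define Z where "Z x N = pick (snd x) (\<lambda>b G. h (B (add_mset (fst x, add_mset y G) N)) b)" for x N
  define T where "T x N = pick (snd x) (\<lambda>b G. \<Sum>u\<in>#graft b y. h (B (add_mset (fst x, G) N)) u)"
    for x N
  have "(\<Sum>u\<in>#graft t y. prune_sum u h)
      = pick M (\<lambda>x N. \<Sum>v\<in>#graft_at y x. pick (snd v)
          (\<lambda>b G. h (B (add_mset (fst v, G) N)) b)) + X1"
    by (simp add: B prune_sum_B sum_graft_B sum_mset.distrib pick_distrib X1_def pick_sum_mset)
  also have "\<dots> = pick M (\<lambda>x N. h (B (add_mset x N)) y + Z x N + T x N + Y1 x N) + X1"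
    by (simp add: sum_graft_at sum_mset.distrib pick_distrib Y1_def Z_def T_def ac_simps)
  finally have "(\<Sum>u\<in>#graft t y. prune_sum u h)
      = pick M (\<lambda>x N. h (B (add_mset x N)) y + Z x N + T x N + Y1 x N) + X1" .
  moreover have "prune_sum t (\<lambda>a b. (\<Sum>u\<in>#graft a y. h u b) + (\<Sum>u\<in>#graft b y. h a u))
      = pick M (\<lambda>x N. Z x N + T x N + Y2 x N) + X2"
    by (simp add: X2_def B prune_sum_B sum_graft_B sum_graft_at sum_mset.distrib pick_distrib
        Y2_def Z_def T_def ac_simps)
  ultimately show ?thesis
    by (simp add: B Y X pick_distrib roots ac_simps)
qed

section \<open>Degrees, decorations and numbers of roots\<close>

lemma in_pick_iff: "x \<in># pick M f \<longleftrightarrow> (\<exists>y N. M = add_mset y N \<and> x \<in># f y N)"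
proof
  assume "x \<in># pick M f"
  then obtain y where "y \<in># M" "x \<in># f y (M - {#y#})" by (auto simp: pick_def)
  then show "\<exists>y N. M = add_mset y N \<and> x \<in># f y N" by (metis insert_DiffM)
qed auto

lemma in_graft_at: "v \<in># graft_at y (d, F) \<longleftrightarrow>
    v = (d, add_mset y F) \<or> (\<exists>t G u. F = add_mset t G \<and> u \<in># graft t y \<and> v = (d, add_mset u G))"
  by (auto simp: graft_at_def in_pick_iff)

lemma in_graft_B: "u \<in># graft (B M) y \<longleftrightarrow>
    (\<exists>d F N v. M = add_mset (d, F) N \<and> v \<in># graft_at y (d, F) \<and> u = B (add_mset v N))"
  by (simp add: graft_B in_pick_iff image_iff Bex_def)

lemma in_prunings_B: "(a, b) \<in># prunings (B M) \<longleftrightarrow>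
    (\<exists>d F N. M = add_mset (d, add_mset b F) N \<and> a = B (add_mset (d, F) N))"
  by (auto simp: prunings_def in_pick_iff)

lemma B_in_PT_iff: "B M \<in> PT D \<longleftrightarrow>
    M \<noteq> {#} \<and> (\<forall>(d, F) \<in> set_mset M. d \<in> D \<and> (\<forall>t \<in> set_mset F. t \<in> PT D))"
proof
  assume "B M \<in> PT D"
  then show "M \<noteq> {#} \<and> (\<forall>(d, F) \<in> set_mset M. d \<in> D \<and> (\<forall>t \<in> set_mset F. t \<in> PT D))"
    by cases auto
qed (auto intro: PT.intros)

lemma size_graft: "u \<in># graft t y \<Longrightarrow> Suc (size u) = Suc (size t) + Suc (size y)"
proof (induction t arbitrary: u)
  case (B M)
  from B.prems obtain d F N v
    where M: "M = add_mset (d, F) N" and v: "v \<in># graft_at y (d, F)" and u: "u = B (add_mset v N)"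
    by (auto simp: in_graft_B)
  from v consider "v = (d, add_mset y F)"
    | s G w where "F = add_mset s G" "w \<in># graft s y" "v = (d, add_mset w G)"
    by (auto simp: in_graft_at)
  then show ?case
  proof cases
    case 2
    then show ?thesis using B.IH[of "(d, F)" F s w] by (simp add: u M)
  qed (simp add: u M)
qed

lemma graft_in_PT: "u \<in># graft t y \<Longrightarrow> t \<in> PT D \<Longrightarrow> y \<in> PT D \<Longrightarrow> u \<in> PT D"
proof (induction t arbitrary: u)
  case (B M)
  from B.prems obtain d F N v
    where M: "M = add_mset (d, F) N" and v: "v \<in># graft_at y (d, F)" and u: "u = B (add_mset v N)"
    by (auto simp: in_graft_B)
  from v consider "v = (d, add_mset y F)"
    | s G w where "F = add_mset s G" "w \<in># graft s y" "v = (d, add_mset w G)"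
    by (auto simp: in_graft_at)
  then show ?case
  proof cases
    case 2
    then show ?thesis using B.IH[of "(d, F)" F s w] B.prems by (auto simp: u M B_in_PT_iff)
  qed (use B.prems in \<open>auto simp: u M B_in_PT_iff\<close>)
qed

lemma size_prunings: "(a, b) \<in># prunings t \<Longrightarrow> Suc (size a) + Suc (size b) = Suc (size t)"
  by (cases t) (auto simp: in_prunings_B)

lemma prunings_in_PT: "(a, b) \<in># prunings t \<Longrightarrow> t \<in> PT D \<Longrightarrow> a \<in> PT D \<and> b \<in> PT D"
  by (cases t) (auto simp: in_prunings_B B_in_PT_iff)

text \<open>Together with \<open>size_roots_prunings\<close> this lets the factor 1/k of \<delta> be
  pulled out of sums over graftings and over repeated prunings.\<close>

lemma size_roots_graft: "u \<in># graft t y \<Longrightarrow> size (roots u) = size (roots t)"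
  by (cases t) (auto simp: in_graft_B)

lemma size_roots_prunings: "(a, b) \<in># prunings t \<Longrightarrow> size (roots a) = size (roots t)"
  by (cases t) (auto simp: in_prunings_B)

lemma delta_ptree_eq: "delta_ptree t =
    scale (1 / of_nat (size (roots t))) (\<Sum>p\<in>#prunings t. Poly_Mapping.single p 1)"
proof (cases t)
  case (B M)
  show ?thesis
    unfolding B delta_ptree.simps roots.simps prunings_def sum_mset_pick
    by (simp add: pick_def case_prod_unfold)
qed

section \<open>Linear extension\<close>

lemma lookup_scale [simp]: "Poly_Mapping.lookup (scale c x) a = c * Poly_Mapping.lookup x a"
  by (simp add: scale_def map.rep_eq when_def)

global_interpretation pm: vector_space "scale :: 'k::field \<Rightarrow> ('a \<Rightarrow>\<^sub>0 'k) \<Rightarrow> _"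
  by unfold_locales (auto intro!: poly_mapping_eqI simp: lookup_add algebra_simps)

abbreviation single1 :: "'a \<Rightarrow> 'a \<Rightarrow>\<^sub>0 'k::field" where
  "single1 a \<equiv> Poly_Mapping.single a 1"

definition supported_on :: "'a set \<Rightarrow> ('a \<Rightarrow>\<^sub>0 'k::field) set" where
  "supported_on X = {x. Poly_Mapping.keys x \<subseteq> X}"

lemma subspace_supported_on: "pm.subspace (supported_on X :: ('a \<Rightarrow>\<^sub>0 'k::field) set)"
  unfolding pm.subspace_def supported_on_def
proof (intro conjI ballI allI)
  fix x y :: "'a \<Rightarrow>\<^sub>0 'k" assume "x \<in> {x. Poly_Mapping.keys x \<subseteq> X}" "y \<in> {x. Poly_Mapping.keys x \<subseteq> X}"
  then show "x + y \<in> {x. Poly_Mapping.keys x \<subseteq> X}" using Poly_Mapping.keys_add[of x y] by auto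
qed (auto simp: in_keys_iff)

lemma single1_supported_on [simp]: "single1 a \<in> supported_on X \<longleftrightarrow> a \<in> X"
  by (simp add: supported_on_def)

lemma supported_on_mono: "x \<in> supported_on X \<Longrightarrow> X \<subseteq> Y \<Longrightarrow> x \<in> supported_on Y"
  by (auto simp: supported_on_def)

text \<open>\<open>lin_ext\<close> with values in any space whose scaling is \<open>s\<close>, so
  that maps into spaces of trees, into their tensor square and into the free algebra are treated
  alike.\<close>

definition lext :: "('k::field \<Rightarrow> 'b \<Rightarrow> 'b) \<Rightarrow> ('a \<Rightarrow> 'b) \<Rightarrow> ('a \<Rightarrow>\<^sub>0 'k) \<Rightarrow> 'b::comm_monoid_add" where
  "lext s f x = (\<Sum>a\<in>Poly_Mapping.keys x. s (Poly_Mapping.lookup x a) (f a))"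

lemma lin_ext_eq_lext: "lin_ext = lext scale"
  by (intro ext) (simp add: lin_ext_def lext_def)

lemma lext_cong:
  assumes "x \<in> supported_on X" and "\<And>a. a \<in> X \<Longrightarrow> f a = g a"
  shows "lext s f x = lext s g x"
  unfolding lext_def using assms by (intro sum.cong) (auto simp: supported_on_def)

context vector_space
begin

lemma lext_superset:
  assumes "finite S" "Poly_Mapping.keys x \<subseteq> S"
  shows "lext scale f x = (\<Sum>a\<in>S. Poly_Mapping.lookup x a *s f a)"
  unfolding lext_def using assms by (intro sum.mono_neutral_left) (auto simp: in_keys_iff)

lemma module_hom_lext: "module_hom Defs.scale scale (lext scale f)"
proof -
  have "lext scale f (x + y) = lext scale f x + lext scale f y" for x y
  proof -
    let ?S = "Poly_Mapping.keys x \<union> Poly_Mapping.keys y"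
    have "Poly_Mapping.keys (x + y) \<subseteq> ?S" by (rule Poly_Mapping.keys_add)
    then show ?thesis
      by (simp add: lext_superset[of ?S] lookup_add scale_left_distrib sum.distrib)
  qed
  moreover have "lext scale f (Defs.scale c x) = c *s lext scale f x" for c x
    by (subst lext_superset[of "Poly_Mapping.keys x"])
      (auto simp: lext_def in_keys_iff scale_sum_right)
  ultimately show ?thesis
    by (simp add: module_hom_iff module_axioms pm.module_axioms)
qed

lemma lext_single [simp]: "lext scale f (Poly_Mapping.single a c) = c *s f a"
  by (subst lext_superset[of "{a}"]) auto

lemma lext_add: "lext scale (\<lambda>a. f a + g a) x = lext scale f x + lext scale g x"
  by (simp add: lext_def scale_right_distrib sum.distrib)

lemma hom_scale: "module_hom scale scale (\<lambda>x. c *s x)"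
  by (simp add: module_hom_iff module_axioms scale_right_distrib mult.commute)

lemma hom_ident: "module_hom scale scale (\<lambda>x. x)"
  by (simp add: module_hom_iff module_axioms)

lemma lext_in_subspace:
  assumes "subspace S" "x \<in> supported_on X" "\<And>a. a \<in> X \<Longrightarrow> f a \<in> S"
  shows "lext scale f x \<in> S"
  unfolding lext_def using assms
  by (intro subspace_sum subspace_scale) (auto simp: supported_on_def)

end

lemma module_hom_sum_mset:
  assumes "module_hom s1 s2 f"
  shows "f (\<Sum>x\<in>#A. g x) = (\<Sum>x\<in>#A. f (g x))"
  by (induction A) (simp_all add: module_hom.zero[OF assms] module_hom.add[OF assms])

lemma (in vector_space) subspace_sum_mset:
  assumes "subspace S" "\<And>x. x \<in># A \<Longrightarrow> f x \<in> S"
  shows "(\<Sum>x\<in>#A. f x) \<in> S"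
  using assms(2) by (induction A) (auto simp: subspace_0 assms(1) subspace_add)

lemma (in vector_space) sum_mset_const: "(\<Sum>x\<in>#A. v) = scale (of_nat (size A)) v"
  by (induction A) (simp_all add: scale_left_distrib)

lemma module_hom_lext_comp:
  assumes "module_hom s1 s2 f"
  shows "f (lext s1 g x) = lext s2 (\<lambda>a. f (g a)) x"
  by (simp add: lext_def module_hom.sum[OF assms] module_hom.scale[OF assms])

lemma lext_single1: "lext scale single1 x = x"
proof (rule poly_mapping_eqI)
  fix a
  show "Poly_Mapping.lookup (lext scale single1 x) a = Poly_Mapping.lookup x a"
    by (auto simp: lext_def lookup_sum lookup_single when_def in_keys_iff if_distrib
        cong: if_cong)
qed

lemma module_hom_eq_lext:
  assumes "module_hom scale s f"
  shows "f x = lext s (\<lambda>a. f (single1 a)) x"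
  using module_hom_lext_comp[OF assms, of single1 x] by (simp add: lext_single1)

lemma module_hom_eqI:
  assumes "module_hom scale s f" "module_hom scale s g" "x \<in> supported_on X"
    and "\<And>a. a \<in> X \<Longrightarrow> f (single1 a) = g (single1 a)"
  shows "f x = g x"
  unfolding module_hom_eq_lext[OF assms(1), of x] module_hom_eq_lext[OF assms(2), of x]
  using assms(3,4) by (rule lext_cong)

lemma module_hom_plus:
  "module_hom s1 s2 f \<Longrightarrow> module_hom s1 s2 g \<Longrightarrow> module_hom s1 s2 (\<lambda>x. f x + g x)"
  by (simp add: module_hom_iff module.scale_right_distrib ac_simps)

lemma module_hom_minus:
  "module_hom s1 s2 f \<Longrightarrow> module_hom s1 s2 g \<Longrightarrow> module_hom s1 s2 (\<lambda>x. f x - g x)"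
  by (simp add: module_hom_iff module.scale_right_diff_distrib)

lemma module_hom_smult: "module_hom s1 s2 f \<Longrightarrow> module_hom s1 s2 (\<lambda>x. s2 c (f x))"
  by (simp add: module_hom_iff module.scale_right_distrib module.scale_scale mult.commute)

lemma module_hom_comp: "module_hom s1 s2 f \<Longrightarrow> module_hom s2 s3 g \<Longrightarrow> module_hom s1 s3 (\<lambda>x. g (f x))"
  using module_hom_compose[of s1 s2 f s3 g] by (simp add: o_def)

lemma (in vector_space) module_hom_lext_fun:
  assumes "\<And>a. module_hom s1 scale (\<lambda>y. f a y)"
  shows "module_hom s1 scale (\<lambda>y. lext scale (\<lambda>a. f a y) x)"
  using assms
  by (simp add: module_hom_iff lext_def scale_right_distrib sum.distrib scale_sum_right mult.commute)

lemmas pm_hom_lext = pm.module_hom_lext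

section \<open>Tensors, and the product and \<delta> as linear maps\<close>

definition tens :: "('a \<Rightarrow>\<^sub>0 'k::field) \<Rightarrow> ('b \<Rightarrow>\<^sub>0 'k) \<Rightarrow> ('a \<times> 'b) \<Rightarrow>\<^sub>0 'k" where
  "tens x y = lext scale (\<lambda>a. lext scale (\<lambda>b. single1 (a, b)) y) x"

lemma tens_hom_left: "module_hom scale scale (\<lambda>x. tens x y)"
  unfolding tens_def by (rule pm_hom_lext)

lemma tens_hom_right: "module_hom scale scale (tens x)"
  unfolding tens_def by (intro pm.module_hom_lext_fun pm_hom_lext)

lemma tens_single1: "tens (single1 a) (single1 b) = single1 (a, b)"
  by (simp add: tens_def)

text \<open>Universal property of the tensor product. Both sides are bilinear, so they need only be
  compared on pairs of basis elements.\<close>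

lemma lext_tens:
  assumes "\<And>y. module_hom scale s (\<lambda>x. f x y)" "\<And>x. module_hom scale s (f x)"
  shows "lext s (\<lambda>p. f (single1 (fst p)) (single1 (snd p))) (tens x y) = f x y"
proof -
  interpret vector_space s using assms(1) unfolding module_hom_iff module_iff_vector_space by blast
  have l: "module_hom scale s (\<lambda>x. lext s (\<lambda>p. f (single1 (fst p)) (single1 (snd p))) (tens x y))" for y
    by (rule module_hom_comp[OF tens_hom_left module_hom_lext])
  have r: "module_hom scale s (\<lambda>y. lext s (\<lambda>p. f (single1 (fst p)) (single1 (snd p))) (tens x y))" for x
    by (rule module_hom_comp[OF tens_hom_right module_hom_lext])
  show ?thesis
    apply (rule module_hom_eqI[OF l assms(1), of x UNIV], simp add: supported_on_def)
    apply (rule module_hom_eqI[OF r assms(2), of y UNIV], simp add: supported_on_def)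
    apply (simp add: tens_single1)
    done
qed

lemma mult_hom_left: "module_hom scale scale (\<lambda>x. ptree_mult x y)"
  unfolding ptree_mult_def lin_ext_eq_lext by (rule pm_hom_lext)

lemma mult_hom_right: "module_hom scale scale (ptree_mult x)"
  unfolding ptree_mult_def lin_ext_eq_lext by (intro pm.module_hom_lext_fun pm_hom_lext)

lemma mult_single1: "ptree_mult (single1 t) (single1 u) = (\<Sum>v\<in>#graft t u. single1 v)"
  by (simp add: ptree_mult_def lin_ext_eq_lext)

lemma delta_hom: "module_hom scale scale delta"
  unfolding delta_def lin_ext_eq_lext by (rule pm_hom_lext)

lemma delta_single1: "delta (single1 t) =
    scale (1 / of_nat (size (roots t))) (\<Sum>p\<in>#prunings t. single1 p)"
  by (simp add: delta_def lin_ext_eq_lext delta_ptree_eq)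

lemma (in vector_space) lext_delta_single1: "lext scale h (delta (single1 t)) =
    scale (1 / of_nat (size (roots t))) (\<Sum>p\<in>#prunings t. h p)"
  using module_hom_sum_mset[OF module_hom_lext[of h], of "\<lambda>p. single1 p"]
  by (simp add: delta_single1 module_hom.scale[OF module_hom_lext])

text \<open>Trilinearity reduces the three arguments in turn to basis trees, where
  \<open>graft_prelie\<close> applies with values in the vector space.\<close>

lemma ptree_mult_prelie:
  fixes x y z :: "'d ptree \<Rightarrow>\<^sub>0 'k::field"
  shows "ptree_mult (ptree_mult x y) z + ptree_mult x (ptree_mult z y)
    = ptree_mult (ptree_mult x z) y + ptree_mult x (ptree_mult y z)"
proof -
  note homs = mult_hom_left mult_hom_right pm.hom_ident
    module_hom_comp[OF _ mult_hom_left] module_hom_comp[OF _ mult_hom_right] module_hom_plus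
  have U: "x \<in> supported_on UNIV" for x :: "'d ptree \<Rightarrow>\<^sub>0 'k"
    by (simp add: supported_on_def)
  show ?thesis
    apply (rule module_hom_eqI[OF _ _ U[of x], of scale "\<lambda>x. _ x" "\<lambda>x. _ x"])
      apply (intro homs)+
    apply (rule module_hom_eqI[OF _ _ U[of y], of scale "\<lambda>y. _ y" "\<lambda>y. _ y"])
      apply (intro homs)+
    apply (rule module_hom_eqI[OF _ _ U[of z], of scale "\<lambda>z. _ z" "\<lambda>z. _ z"])
      apply (intro homs)+
    apply (simp add: mult_single1 module_hom_sum_mset[OF mult_hom_left]
       module_hom_sum_mset[OF mult_hom_right] graft_prelie)
    done
qed

text \<open>False for \<open>x = B {#}\<close>, where grafting and \<open>\<delta>\<close> are empty sums; hence the support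
  condition.\<close>

lemma delta_mult:
  fixes x y :: "'d ptree \<Rightarrow>\<^sub>0 'k::field_char_0"
  assumes "x \<in> supported_on (PT D)"
  shows "delta (ptree_mult x y) = tens x y
    + lext scale (\<lambda>p. tens (ptree_mult (single1 (fst p)) y) (single1 (snd p))
         + tens (single1 (fst p)) (ptree_mult (single1 (snd p)) y)) (delta x)"
proof (rule module_hom_eqI[OF _ _ assms, of scale "\<lambda>x. _ x" "\<lambda>x. _ x"])
  note homs = mult_hom_left mult_hom_right pm.hom_ident tens_hom_left tens_hom_right
    module_hom_comp[OF mult_hom_left delta_hom] 
    module_hom_comp[OF mult_hom_right delta_hom] module_hom_comp[OF delta_hom pm_hom_lext]
    module_hom_comp[OF mult_hom_right tens_hom_left] 
    module_hom_comp[OF mult_hom_right tens_hom_right] 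
    pm.module_hom_lext_fun module_hom_plus
  show "module_hom scale scale (\<lambda>x. delta (ptree_mult x y))" by (intro homs)
  show "module_hom scale scale (\<lambda>x. tens x y
    + lext scale (\<lambda>p. tens (ptree_mult (single1 (fst p)) y) (single1 (snd p))
         + tens (single1 (fst p)) (ptree_mult (single1 (snd p)) y)) (delta x))" by (intro homs)
  fix t :: "'d ptree" assume "t \<in> PT D"
  \<comment> \<open>A tree in \<open>PT D\<close> has a root, so in characteristic zero the factor
    1/k cancels against the k equal terms that \<open>prune_graft\<close> produces.\<close>
  then have k: "(of_nat (size (roots t)) :: 'k) \<noteq> 0"
    by (cases t) (auto simp: B_in_PT_iff)
  show "delta (ptree_mult (single1 t) y) = tens (single1 t) y
    + lext scale (\<lambda>p. tens (ptree_mult (single1 (fst p)) y) (single1 (snd p))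
         + tens (single1 (fst p)) (ptree_mult (single1 (snd p)) y)) (delta (single1 t))"
  proof (rule module_hom_eqI[of scale "\<lambda>y. _ y" "\<lambda>y. _ y" y UNIV])
    show "y \<in> supported_on UNIV" by (simp add: supported_on_def)
    show "module_hom scale scale (\<lambda>y. delta (ptree_mult (single1 t) y))" by (intro homs)
    show "module_hom scale scale (\<lambda>y. tens (single1 t) y
      + lext scale (\<lambda>p. tens (ptree_mult (single1 (fst p)) y) (single1 (snd p))
           + tens (single1 (fst p)) (ptree_mult (single1 (snd p)) y)) (delta (single1 t)))"
      by (intro homs)
    fix u :: "'d ptree"
    let ?c = "1 / of_nat (size (roots t)) :: 'k"
    have "delta (ptree_mult (single1 t) (single1 u))
      = (\<Sum>v\<in>#graft t u. scale ?c (\<Sum>p\<in>#prunings v. single1 p))"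
      unfolding mult_single1 module_hom_sum_mset[OF delta_hom] delta_single1
      by (rule arg_cong[of _ _ sum_mset], rule image_mset_cong) (simp add: size_roots_graft)
    also have "\<dots> = scale ?c (\<Sum>v\<in>#graft t u. \<Sum>p\<in>#prunings v. single1 p)"
      by (rule module_hom_sum_mset[OF pm.hom_scale, symmetric])
    also have "\<dots> = scale ?c ((\<Sum>i\<in>#roots t. single1 (t, u))
      + prune_sum t (\<lambda>a b. (\<Sum>v\<in>#graft a u. single1 (v, b)) + (\<Sum>v\<in>#graft b u. single1 (a, v))))"
      using prune_graft[of "\<lambda>a b. single1 (a, b) :: _ \<Rightarrow>\<^sub>0 'k" t u] by simp
    also have "(\<Sum>i\<in>#roots t. single1 (t, u)) = scale (of_nat (size (roots t)) :: 'k) (single1 (t, u))"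
      by (rule pm.sum_mset_const)
    finally show "delta (ptree_mult (single1 t) (single1 u :: _ \<Rightarrow>\<^sub>0 'k)) = tens (single1 t) (single1 u)
      + lext scale (\<lambda>p. tens (ptree_mult (single1 (fst p)) (single1 u)) (single1 (snd p))
           + tens (single1 (fst p)) (ptree_mult (single1 (snd p)) (single1 u))) (delta (single1 t))"
      using k by (simp add: pm.lext_delta_single1 tens_single1 mult_single1
        module_hom_sum_mset[OF tens_hom_left] module_hom_sum_mset[OF tens_hom_right]
        pm.scale_right_distrib)
  qed
qed

text \<open>The linear form of \<open>prune_prune_commute\<close>: both cuts carry the same factor
  1/k. Testing with an arbitrary function \<open>g\<close> of three trees avoids a triple tensor
  power.\<close>

lemma (in vector_space) delta_delta_commute:
  "lext scale (\<lambda>p. lext scale (\<lambda>q. g (fst q) (snd q) (snd p)) (delta (single1 (fst p)))) (delta x)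
 = lext scale (\<lambda>p. lext scale (\<lambda>q. g (fst q) (snd p) (snd q)) (delta (single1 (fst p)))) (delta x)"
proof (rule module_hom_eqI[of scale "\<lambda>x. _ x" "\<lambda>x. _ x" x UNIV])
  show "x \<in> supported_on UNIV" by (simp add: supported_on_def)
  fix t :: "'c ptree"
  have eq: "(\<Sum>p\<in>#prunings t. scale (1 / of_nat (size (roots (fst p)))) (h p))
     = scale (1 / of_nat (size (roots t))) (\<Sum>p\<in>#prunings t. h p)" for h
  proof -
    have "(\<Sum>p\<in>#prunings t. scale (1 / of_nat (size (roots (fst p)))) (h p))
      = (\<Sum>p\<in>#prunings t. scale (1 / of_nat (size (roots t))) (h p))"
      by (rule arg_cong[of _ _ sum_mset], rule image_mset_cong) (auto dest: size_roots_prunings)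
    then show ?thesis
      by (simp add: module_hom_sum_mset[OF hom_scale])
  qed
  show "lext scale (\<lambda>p. lext scale (\<lambda>q. g (fst q) (snd q) (snd p)) (delta (single1 (fst p)))) (delta (single1 t))
 = lext scale (\<lambda>p. lext scale (\<lambda>q. g (fst q) (snd p) (snd q)) (delta (single1 (fst p)))) (delta (single1 t))"
    using prune_prune_commute[of "\<lambda>c d b. g c d b" t]
    by (simp add: lext_delta_single1 eq)
qed (intro module_hom_comp[OF delta_hom module_hom_lext])+

text \<open>A cut splits the degree \<open>Suc (size t)\<close> between its two parts. Both parts
  have positive degree, so each factor has degree strictly below \<open>m\<close>; the inductions on
  the degree rest on this.\<close>

lemma delta_support:
  assumes "x \<in> supported_on (PT D \<inter> {t. size t < m})"
  shows "delta x \<in> supported_on {(a, b). a \<in> PT D \<and> b \<in> PT D \<and> Suc (size a) + Suc (size b) \<le> m}"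
  unfolding delta_def lin_ext_eq_lext
proof (rule pm.lext_in_subspace[OF subspace_supported_on assms])
  fix t assume t: "t \<in> PT D \<inter> {t. size t < m}"
  have "(\<Sum>p\<in>#prunings t. single1 p)
      \<in> supported_on {(a, b). a \<in> PT D \<and> b \<in> PT D \<and> Suc (size a) + Suc (size b) \<le> m}"
    using t prunings_in_PT[of _ _ t D] size_prunings[of _ _ t]
    by (intro pm.subspace_sum_mset subspace_supported_on) auto
  then show "delta_ptree t \<in> supported_on {(a, b). a \<in> PT D \<and> b \<in> PT D \<and> Suc (size a) + Suc (size b) \<le> m}"
    unfolding delta_ptree_eq by (intro pm.subspace_scale subspace_supported_on)
qed

section \<open>The filtration\<close>

text \<open>The degree of \<open>t\<close> is \<open>Suc (size t)\<close>, which is additive under grafting (and is not the number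
  of vertices, since \<open>size\<close> also counts multiset elements).\<close>

abbreviation graded_upto :: "'d set \<Rightarrow> nat \<Rightarrow> ('d ptree \<Rightarrow>\<^sub>0 'k::field) set" where
  "graded_upto D m \<equiv> supported_on (PT D \<inter> {t. size t < m})"

lemma graded_upto_exists:
  assumes "x \<in> supported_on (PT D)"
  obtains m where "x \<in> graded_upto D m"
proof -
  have "x \<in> graded_upto D (Suc (Max (size ` Poly_Mapping.keys x)))"
    using assms by (auto simp: supported_on_def le_imp_less_Suc)
  then show ?thesis by (rule that)
qed

lemma graded_upto_mono: "x \<in> graded_upto D m \<Longrightarrow> m \<le> n \<Longrightarrow> x \<in> graded_upto D n"
  by (auto simp: supported_on_def)

lemma graded_upto_PT: "x \<in> graded_upto D m \<Longrightarrow> x \<in> supported_on (PT D)"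
  by (auto simp: supported_on_def)

lemma mult_graded_upto:
  assumes "x \<in> graded_upto D m" "y \<in> graded_upto D n"
  shows "ptree_mult x y \<in> graded_upto D (m + n)"
  unfolding ptree_mult_def lin_ext_eq_lext
proof (intro pm.lext_in_subspace[OF _ assms(1)] pm.lext_in_subspace[OF _ assms(2)]
    pm.subspace_sum_mset subspace_supported_on)
  fix t u v assume "t \<in> PT D \<inter> {t. size t < m}" "u \<in> PT D \<inter> {t. size t < n}" "v \<in># graft t u"
  then show "single1 v \<in> graded_upto D (m + n)"
    using graft_in_PT[of v t u D] size_graft[of v t u] by simp
qed

section \<open>The operator \<open>nu\<close> and its action on the filtration\<close>

definition nu :: "('d ptree \<Rightarrow>\<^sub>0 'k::field) \<Rightarrow> 'd ptree \<Rightarrow>\<^sub>0 'k" where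
  "nu x = lext scale (\<lambda>p. ptree_mult (single1 (fst p)) (single1 (snd p))) (delta x)"

lemma nu_hom: "module_hom scale scale nu"
  unfolding nu_def by (rule module_hom_comp[OF delta_hom pm_hom_lext])

lemmas nu_add = module_hom.add[OF nu_hom]
lemmas nu_diff = module_hom.diff[OF nu_hom]
lemmas nu_scale = module_hom.scale[OF nu_hom]

lemma nu_graded_upto:
  assumes "x \<in> graded_upto D m"
  shows "nu x \<in> graded_upto D m"
  unfolding nu_def
proof (rule pm.lext_in_subspace[OF subspace_supported_on delta_support[OF assms]])
  fix p assume "p \<in> {(a, b). a \<in> PT D \<and> b \<in> PT D \<and> Suc (size a) + Suc (size b) \<le> m}"
  then obtain a b where p: "p = (a, b)" "a \<in> PT D" "b \<in> PT D" "Suc (size a) + Suc (size b) \<le> m"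
    by auto
  have "ptree_mult (single1 a) (single1 b) \<in> graded_upto D (Suc (size a) + Suc (size b))"
    by (rule mult_graded_upto) (auto simp: p)
  then show "ptree_mult (single1 (fst p)) (single1 (snd p)) \<in> graded_upto D m"
    using graded_upto_mono p by auto
qed

lemma delta_support_PT:
  assumes "x \<in> supported_on (PT D)"
  shows "delta x \<in> supported_on (PT D \<times> PT D)"
proof -
  obtain m where "x \<in> graded_upto D m" by (rule graded_upto_exists[OF assms])
  from delta_support[OF this] show ?thesis by (rule supported_on_mono) auto
qed

text \<open>\<open>delta_mult\<close> is applied to each product x' \<bullet> x''. This creates the
  terms (a \<bullet> x'') \<otimes> b, with a \<otimes> b running over \<delta>(x'). By
  \<open>delta_delta_commute\<close>, b and x'' may be exchanged, and the terms add up to nu(x')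
  \<otimes> x''.\<close>

lemma delta_nu:
  fixes x :: "'d ptree \<Rightarrow>\<^sub>0 'k::field_char_0"
  assumes "x \<in> supported_on (PT D)"
  shows "delta (nu x) = delta x
    + lext scale (\<lambda>p. tens (nu (single1 (fst p))) (single1 (snd p))) (delta x)
    + lext scale (\<lambda>p. lext scale (\<lambda>q. tens (single1 (fst q))
        (ptree_mult (single1 (snd q)) (single1 (snd p)))) (delta (single1 (fst p)))) (delta x)"
proof -
  have "delta (nu x) = lext scale (\<lambda>p. delta (ptree_mult (single1 (fst p)) (single1 (snd p)))) (delta x)"
    unfolding nu_def by (rule module_hom_lext_comp[OF delta_hom])
  also have "\<dots> = lext scale (\<lambda>p. tens (single1 (fst p)) (single1 (snd p))
    + lext scale (\<lambda>q. tens (ptree_mult (single1 (fst q)) (single1 (snd p))) (single1 (snd q))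
         + tens (single1 (fst q)) (ptree_mult (single1 (snd q)) (single1 (snd p))))
         (delta (single1 (fst p)))) (delta x)"
    by (rule lext_cong[OF delta_support_PT[OF assms]], rule delta_mult) auto
  also have "\<dots> = delta x
    + lext scale (\<lambda>p. lext scale (\<lambda>q. tens (ptree_mult (single1 (fst q)) (single1 (snd p))) (single1 (snd q)))
         (delta (single1 (fst p)))) (delta x)
    + lext scale (\<lambda>p. lext scale (\<lambda>q. tens (single1 (fst q)) (ptree_mult (single1 (snd q)) (single1 (snd p))))
         (delta (single1 (fst p)))) (delta x)"
    by (simp add: pm.lext_add tens_single1 lext_single1 add.assoc)
  also have "lext scale (\<lambda>p. lext scale (\<lambda>q. tens (ptree_mult (single1 (fst q)) (single1 (snd p))) (single1 (snd q)))
         (delta (single1 (fst p)))) (delta x)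
     = lext scale (\<lambda>p. lext scale (\<lambda>q. tens (ptree_mult (single1 (fst q)) (single1 (snd q))) (single1 (snd p)))
         (delta (single1 (fst p)))) (delta x)"
    by (rule pm.delta_delta_commute[of "\<lambda>c d b. tens (ptree_mult (single1 c) (single1 b)) (single1 d)"])
  also have "\<dots> = lext scale (\<lambda>p. tens (nu (single1 (fst p))) (single1 (snd p))) (delta x)"
    unfolding nu_def module_hom_lext_comp[OF tens_hom_left] ..
  finally show ?thesis .
qed

text \<open>Up to a shift of the index, \<open>fil D n\<close> consists of the elements killed by iterating \<open>\<delta>\<close> on
  the left factor \<open>n\<close> times.\<close>

primrec fil :: "'d set \<Rightarrow> nat \<Rightarrow> ('d ptree \<Rightarrow>\<^sub>0 'k::field) set" where
  "fil D 0 = {0}"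
| "fil D (Suc n) = {x \<in> supported_on (PT D). delta x \<in> pm.span {tens a b | a b. a \<in> fil D n}}"

lemma subspace_fil: "pm.subspace (fil D n :: ('d ptree \<Rightarrow>\<^sub>0 'k::field) set)"
proof (cases n)
  case (Suc m)
  have *: "pm.subspace {x. delta x \<in> pm.span S}" for S :: "(('d ptree \<times> 'd ptree) \<Rightarrow>\<^sub>0 'k) set"
    unfolding pm.subspace_def
    by (auto simp: module_hom.zero[OF delta_hom] module_hom.add[OF delta_hom]
        module_hom.scale[OF delta_hom] intro: pm.span_zero pm.span_add pm.span_scale)
  show ?thesis
    unfolding Suc fil.simps Collect_conj_eq Collect_mem_eq
    by (intro pm.subspace_inter subspace_supported_on *)
qed (simp add: pm.subspace_single_0)

lemma ker_delta_eq: "ker_delta D = {x \<in> supported_on (PT D). delta x = 0}"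
  by (simp add: ker_delta_def g_PT_def supported_on_def)

lemma fil_1: "fil D (Suc 0) = (ker_delta D :: ('d ptree \<Rightarrow>\<^sub>0 'k::field) set)"
proof -
  define T where "T = {tens a b | a b :: 'd ptree \<Rightarrow>\<^sub>0 'k. a \<in> fil D 0}"
  have "T \<subseteq> {0}"
    by (auto simp: T_def module_hom.zero[OF tens_hom_left])
  from pm.span_mono[OF this] have "pm.span T = {0}"
    by (auto simp: pm.span_zero)
  then show ?thesis unfolding T_def by (simp add: ker_delta_eq)
qed

text \<open>Each application of \<delta> lowers the degree of the left factor by at least one, so
  the filtration is exhaustive.\<close>

lemma graded_upto_fil:
  fixes x :: "'d ptree \<Rightarrow>\<^sub>0 'k::field"
  shows "x \<in> graded_upto D m \<Longrightarrow> x \<in> fil D m"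
proof (induction m arbitrary: x)
  case (Suc m)
  have "lext scale single1 (delta x) \<in> pm.span {tens a b | a b. a \<in> fil D m}"
  proof (rule pm.lext_in_subspace[OF pm.subspace_span delta_support[OF Suc.prems]])
    fix p assume "p \<in> {(a, b). a \<in> PT D \<and> b \<in> PT D \<and> Suc (size a) + Suc (size b) \<le> Suc m}"
    then obtain a b where p: "p = (a, b)" "a \<in> PT D" "size a < m" by auto
    then have "(single1 a :: _ \<Rightarrow>\<^sub>0 'k) \<in> fil D m" by (intro Suc.IH) auto
    then show "(single1 p :: _ \<Rightarrow>\<^sub>0 'k) \<in> pm.span {tens a b | a b. a \<in> fil D m}"
      unfolding p tens_single1[symmetric] by (intro pm.span_base) blast
  qed
  then show ?case using graded_upto_PT[OF Suc.prems] by (simp add: lext_single1)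
qed (auto simp: supported_on_def)

text \<open>In the induction step \<open>delta_nu\<close> gives \<delta>(nu x - (n + 1) x) =
  H(\<delta> x), its summand \<delta> x turning n + 1 into n. Here \<open>H\<close> is
  \<open>nu\<close> on the left factor, minus n, plus \<open>T\<close>. On a \<otimes> b the first
  two fall under the induction hypothesis for a, while \<open>T\<close> yields tensors whose left
  factors come from \<delta>(a), one step lower.\<close>

lemma nu_fil:
  fixes x :: "'d ptree \<Rightarrow>\<^sub>0 'k::field_char_0"
  shows "x \<in> fil D (Suc n) \<Longrightarrow> nu x - scale (of_nat n) x \<in> fil D n"
proof (induction n arbitrary: x)
  case 0
  then have "delta x = 0" unfolding fil_1 by (simp add: ker_delta_eq)
  then show ?case by (simp add: nu_def module_hom.zero[OF pm_hom_lext])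
next
  case (Suc n)
  define S where "S n = pm.span {tens a b | a b :: 'd ptree \<Rightarrow>\<^sub>0 'k. a \<in> fil D n}" for n
  define L :: "('d ptree \<times> 'd ptree \<Rightarrow>\<^sub>0 'k) \<Rightarrow> 'd ptree \<times> 'd ptree \<Rightarrow>\<^sub>0 'k"
    where "L z = lext scale (\<lambda>p. tens (nu (single1 (fst p))) (single1 (snd p))) z" for z
  define T :: "('d ptree \<times> 'd ptree \<Rightarrow>\<^sub>0 'k) \<Rightarrow> 'd ptree \<times> 'd ptree \<Rightarrow>\<^sub>0 'k"
    where "T z = lext scale (\<lambda>p. lext scale (\<lambda>q. tens (single1 (fst q))
        (ptree_mult (single1 (snd q)) (single1 (snd p)))) (delta (single1 (fst p)))) z" for z
  define R where "R b z = lext scale (\<lambda>q. tens (single1 (fst q))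
        (ptree_mult (single1 (snd q)) b)) z" for b and z :: "'d ptree \<times> 'd ptree \<Rightarrow>\<^sub>0 'k"
  have R_hom: "module_hom scale scale (R b)" for b
    unfolding R_def by (rule pm_hom_lext)
  have R_tens: "R b (tens c d) = tens c (ptree_mult d b)" for b c d
    unfolding R_def
    by (rule lext_tens[of scale "\<lambda>c d. tens c (ptree_mult d b)"])
      (intro tens_hom_left module_hom_comp[OF mult_hom_left tens_hom_right])+
  have R_S: "R b z \<in> S n" if "z \<in> S n" for b z
    using that unfolding S_def
  proof (induction rule: pm.span_induct_alt)
    case base
    then show ?case by (simp add: module_hom.zero[OF R_hom] pm.span_zero)
  next
    case (step c z w)
    then obtain a d where z: "z = tens a d" "a \<in> fil D n" by auto
    have "R b z \<in> pm.span {tens a b | a b. a \<in> fil D n}"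
      unfolding z R_tens using z(2) by (intro pm.span_base) auto
    with step show ?case
      by (simp add: module_hom.add[OF R_hom] module_hom.scale[OF R_hom] pm.span_add pm.span_scale)
  qed
  have L_tens: "L (tens a b) = tens (nu a) b" for a b
    unfolding L_def
    by (rule lext_tens[of scale "\<lambda>a b. tens (nu a) b"])
      (intro tens_hom_right module_hom_comp[OF nu_hom tens_hom_left])+
  have T_tens: "T (tens a b) = R b (delta a)" for a b
    unfolding T_def R_def
    by (rule lext_tens[of scale "\<lambda>a b. lext scale (\<lambda>q. tens (single1 (fst q))
        (ptree_mult (single1 (snd q)) b)) (delta a)"])
      (intro module_hom_comp[OF delta_hom pm_hom_lext] pm.module_hom_lext_fun
        module_hom_comp[OF mult_hom_right tens_hom_right])+
  have L_hom: "module_hom scale scale L" and T_hom: "module_hom scale scale T"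
    unfolding L_def T_def by (rule pm_hom_lext)+
  define H where "H z = L z - scale (of_nat n) z + T z" for z
  have H_hom: "module_hom scale scale H"
    unfolding H_def
    by (intro module_hom_plus module_hom_minus L_hom T_hom pm.hom_scale)
  have H: "H z \<in> S n" if "z \<in> S (Suc n)" for z
    using that unfolding S_def[of "Suc n"]
  proof (induction rule: pm.span_induct_alt)
    case base
    then show ?case by (simp add: module_hom.zero[OF H_hom] pm.span_zero S_def)
  next
    case (step c z w)
    then obtain a b where z: "z = tens a b" and a: "a \<in> fil D (Suc n)" by blast
    have "tens (nu a - scale (of_nat n) a) b \<in> S n"
      unfolding S_def using Suc.IH[OF a] by (intro pm.span_base) auto
    moreover have "R b (delta a) \<in> S n"
      using a by (intro R_S) (simp add: S_def)
    ultimately have "H z \<in> S n"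
      unfolding H_def z L_tens T_tens S_def
      by (auto simp: module_hom.diff[OF tens_hom_left] module_hom.scale[OF tens_hom_left] intro: pm.span_add)
    with step show ?case
      by (simp add: module_hom.add[OF H_hom] module_hom.scale[OF H_hom] pm.span_add pm.span_scale S_def)
  qed
  have x: "x \<in> supported_on (PT D)" "delta x \<in> S (Suc n)"
    using Suc.prems by (simp_all add: S_def)
  obtain m where "x \<in> graded_upto D m" by (rule graded_upto_exists[OF x(1)])
  then have "nu x \<in> supported_on (PT D)"
    using nu_graded_upto graded_upto_PT by blast
  then have supp: "nu x - scale (of_nat (Suc n)) x \<in> supported_on (PT D)"
    using x by (intro pm.subspace_diff pm.subspace_scale subspace_supported_on)
  have "delta (nu x - scale (of_nat (Suc n)) x) = H (delta x)"
    unfolding module_hom.diff[OF delta_hom] module_hom.scale[OF delta_hom] delta_nu[OF x(1)]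
      H_def L_def T_def by (simp add: algebra_simps pm.scale_left_distrib)
  with H[OF x(2)] supp show ?case by (simp add: S_def)
qed

text \<open>On \<open>fil D (Suc n)\<close> one has x + nu x = (n + 1) x + r with r in
  \<open>fil D n\<close> by \<open>nu_fil\<close>, and n + 1 is never zero. This is the form in
  which the invertibility of 1 + nu enters \<open>inv_mor_mult\<close>.\<close>

lemma vanish_of_one_plus_nu:
  fixes x :: "'d ptree \<Rightarrow>\<^sub>0 'k::field_char_0"
  assumes "module_hom scale s L" "pm.subspace V" "\<And>x. x \<in> V \<Longrightarrow> nu x \<in> V"
    and "\<And>x. x \<in> V \<Longrightarrow> L (x + nu x) = 0"
  shows "x \<in> V \<Longrightarrow> x \<in> fil D n \<Longrightarrow> L x = 0"
proof (induction n arbitrary: x)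
  case 0
  then show ?case by (simp add: module_hom.zero[OF assms(1)])
next
  case (Suc n)
  interpret vector_space s
    using assms(1) unfolding module_hom_iff module_iff_vector_space by blast
  let ?r = "nu x - scale (of_nat n) x"
  have "?r \<in> V" using Suc.prems assms(2,3) by (intro pm.subspace_diff pm.subspace_scale)
  then have "L ?r = 0" using nu_fil[OF Suc.prems(2)] by (rule Suc.IH)
  moreover have "x + nu x = scale (of_nat (Suc n)) x + ?r"
    by (simp add: pm.scale_left_distrib)
  then have "L (x + nu x) = s (of_nat (Suc n)) (L x) + L ?r"
    by (simp only: module_hom.add[OF assms(1)] module_hom.scale[OF assms(1)])
  ultimately have "s (of_nat (Suc n)) (L x) = 0"
    using assms(4)[OF Suc.prems(1)] by simp
  then show ?case by (simp del: of_nat_Suc)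
qed

text \<open>The polynomials \<open>qproj m = (1 - nu/1) \<dots> (1 - nu/m)\<close> in \<open>nu\<close>, and \<open>qrest m\<close> with
  \<open>1 = qproj m + nu qrest m\<close>.\<close>

primrec qproj :: "nat \<Rightarrow> ('d ptree \<Rightarrow>\<^sub>0 'k::field_char_0) \<Rightarrow> 'd ptree \<Rightarrow>\<^sub>0 'k" where
  "qproj 0 x = x"
| "qproj (Suc m) x = qproj m (x - scale (1 / of_nat (Suc m)) (nu x))"

primrec qrest :: "nat \<Rightarrow> ('d ptree \<Rightarrow>\<^sub>0 'k::field_char_0) \<Rightarrow> 'd ptree \<Rightarrow>\<^sub>0 'k" where
  "qrest 0 x = 0"
| "qrest (Suc m) x = scale (1 / of_nat (Suc m)) x
     + qrest m (x - scale (1 / of_nat (Suc m)) (nu x))"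

lemma qproj_hom: "module_hom scale scale (qproj m)"
proof (induction m)
  case (Suc m)
  show ?case unfolding qproj.simps
    by (intro module_hom_comp[OF _ Suc] module_hom_minus pm.hom_ident module_hom_smult nu_hom)
qed (simp add: pm.hom_ident)

lemma qrest_hom: "module_hom scale scale (qrest m)"
proof (induction m)
  case 0
  show ?case by (simp add: module_hom_iff pm.module_axioms)
next
  case (Suc m)
  show ?case unfolding qrest.simps
    by (intro module_hom_comp[OF _ Suc] module_hom_plus module_hom_minus pm.hom_ident
        pm.hom_scale module_hom_smult nu_hom)
qed

lemma qproj_qrest: "x = qproj m x + nu (qrest m x)"
proof (induction m arbitrary: x)
  case (Suc m)
  show ?case
    using Suc[of "x - scale (1 / of_nat (Suc m)) (nu x)"]
    by (simp add: nu_add nu_scale algebra_simps)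
qed (simp add: module_hom.zero[OF nu_hom])

lemma nu_qproj: "nu (qproj m x) = qproj m (nu x)"
  by (induction m arbitrary: x) (simp_all add: nu_diff nu_scale)

lemma nu_qrest: "nu (qrest m x) = qrest m (nu x)"
  by (induction m arbitrary: x) (simp_all add: nu_add nu_diff nu_scale module_hom.zero[OF nu_hom])

text \<open>\<open>qrest m\<close> is a polynomial in \<open>nu\<close>. The subspaces of interest
  are the kernel of \<open>delta\<close> and the pieces of bounded degree.\<close>

lemma qrest_invariant:
  assumes "pm.subspace V" "\<And>x. x \<in> V \<Longrightarrow> nu x \<in> V"
  shows "x \<in> V \<Longrightarrow> qrest m x \<in> V"
proof (induction m arbitrary: x)
  case (Suc m)
  then have "x - scale (1 / of_nat (Suc m)) (nu x) \<in> V"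
    using assms by (intro pm.subspace_diff pm.subspace_scale)
  with Suc show ?case unfolding qrest.simps
    using assms by (intro pm.subspace_add pm.subspace_scale)
qed (simp add: pm.subspace_0[OF assms(1)])

lemma nu_eq_0: "delta x = 0 \<Longrightarrow> nu x = 0"
  by (simp add: nu_def module_hom.zero[OF pm_hom_lext])

lemma qproj_ker: "delta x = 0 \<Longrightarrow> qproj m x = x"
  by (induction m) (simp_all add: nu_eq_0)

lemma subspace_ker_delta: "pm.subspace (ker_delta D :: ('d ptree \<Rightarrow>\<^sub>0 'k::field) set)"
  using subspace_fil[of D "Suc 0"] unfolding fil_1 .

lemma qrest_ker:
  assumes "delta x = 0"
  shows "delta (qrest m x) = 0"
proof (rule qrest_invariant[of "{x. delta x = 0}", simplified])
  show "pm.subspace {x. delta x = 0}"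
    unfolding pm.subspace_def
    by (auto simp: module_hom.zero[OF delta_hom] module_hom.add[OF delta_hom]
        module_hom.scale[OF delta_hom])
qed (use assms in \<open>auto simp: nu_eq_0 module_hom.zero[OF delta_hom]\<close>)

text \<open>By \<open>nu_fil\<close> the factor 1 - nu/j maps \<open>fil D (Suc j)\<close> into
  \<open>fil D j\<close>. The factors act with j descending from m to 1, so the result lies in
  \<open>fil D (Suc 0)\<close>, which is the kernel.\<close>

lemma qproj_fil:
  fixes x :: "'d ptree \<Rightarrow>\<^sub>0 'k::field_char_0"
  shows "x \<in> fil D (Suc m) \<Longrightarrow> qproj m x \<in> ker_delta D"
proof (induction m arbitrary: x)
  case 0
  then show ?case by (simp only: qproj.simps fil_1)
next
  case (Suc m)
  let ?c = "of_nat (Suc m) :: 'k"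
  have "?c \<noteq> 0" by (simp del: of_nat_Suc)
  then have "scale (- (1 / ?c)) (nu x - scale ?c x) = x - scale (1 / ?c) (nu x)"
    by (simp add: pm.scale_right_diff_distrib)
  moreover have "scale (- (1 / ?c)) (nu x - scale ?c x) \<in> fil D (Suc m)"
    by (intro pm.subspace_scale subspace_fil nu_fil Suc.prems)
  ultimately show ?case using Suc.IH by simp
qed

lemma qproj_graded_upto: "x \<in> graded_upto D m \<Longrightarrow> qproj m x \<in> ker_delta D"
  by (intro qproj_fil graded_upto_fil) (erule graded_upto_mono, simp)

lemma qrest_graded_upto: "x \<in> graded_upto D m \<Longrightarrow> qrest n x \<in> graded_upto D m"
  by (rule qrest_invariant[OF subspace_supported_on nu_graded_upto])

text \<open>In x = qproj m x + nu(qrest m x) the first summand lies in the kernel. The second is a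
  combination of products of two trees of strictly smaller degree, to which strong induction
  applies.\<close>

lemma ker_delta_generates:
  fixes V :: "('d ptree \<Rightarrow>\<^sub>0 'k::field_char_0) set"
  assumes "pm.subspace V" "ker_delta D \<subseteq> V"
    and "\<And>x y. x \<in> V \<Longrightarrow> y \<in> V \<Longrightarrow> ptree_mult x y \<in> V"
  shows "supported_on (PT D) \<subseteq> V"
proof
  have *: "x \<in> graded_upto D m \<Longrightarrow> x \<in> V" for m x
  proof (induction m arbitrary: x rule: less_induct)
    case (less m)
    have "nu (qrest m x) \<in> V"
      unfolding nu_def
    proof (rule pm.lext_in_subspace[OF assms(1) delta_support[OF qrest_graded_upto[OF less.prems]]])
      fix p assume "p \<in> {(a, b). a \<in> PT D \<and> b \<in> PT D \<and> Suc (size a) + Suc (size b) \<le> m}"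
      then obtain a b where p: "p = (a, b)" "a \<in> PT D" "b \<in> PT D" "Suc (size a) < m" "Suc (size b) < m"
        by auto
      then have "single1 a \<in> V" "single1 b \<in> V"
        by (auto intro: less.IH)
      then show "ptree_mult (single1 (fst p)) (single1 (snd p)) \<in> V"
        using assms(3) p by simp
    qed
    moreover have "qproj m x \<in> V" using qproj_graded_upto less.prems assms(2) by blast
    ultimately show ?case
      by (subst qproj_qrest[of x m]) (intro pm.subspace_add assms(1))
  qed
  show "x \<in> V" if "x \<in> supported_on (PT D)" for x
    using graded_upto_exists[OF that] * by blast
qed

lemma mult_tens:
  "lext scale (\<lambda>p. ptree_mult (single1 (fst p)) (single1 (snd p))) (tens x y) = ptree_mult x y"
  by (rule lext_tens[OF mult_hom_left mult_hom_right])

section \<open>The free pre-Lie algebra as a type\<close>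

definition full_struct :: "('k::field, 'a \<Rightarrow>\<^sub>0 'k) vec_struct" where
  "full_struct = \<lparr>vcarrier = UNIV, vzero = 0, vadd = (+), vscale = scale\<rparr>"

lemma pterms_full [simp]: "s \<in> pterms full_struct"
  by (simp add: pterms_def full_struct_def)

lemma equivp_free_eq_full: "equivp (free_eq full_struct)"
  by (intro equivpI reflpI sympI transpI) (auto intro: free_eq.refl free_eq.sym free_eq.trans)

text \<open>The free pre-Lie algebra on the whole space with basis \<open>'a\<close>. As a type it carries the
  usual additive structure, which the explicit carrier of \<open>free_prelie\<close> does not.\<close>

quotient_type (overloaded) ('a, 'k) free_pl = "('k::field, 'a \<Rightarrow>\<^sub>0 'k) pterm" / "free_eq full_struct"
  by (rule equivp_free_eq_full)

instantiation free_pl :: (type, field) ab_group_add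
begin

lift_definition zero_free_pl :: "('a, 'b) free_pl" is TZero .

lift_definition plus_free_pl :: "('a, 'b) free_pl \<Rightarrow> ('a, 'b) free_pl \<Rightarrow> ('a, 'b) free_pl" is TAdd
  by (rule free_eq.cong_add)

lift_definition uminus_free_pl :: "('a, 'b) free_pl \<Rightarrow> ('a, 'b) free_pl" is "TScale (- 1)"
  by (rule free_eq.cong_scale)

definition minus_free_pl :: "('a, 'b) free_pl \<Rightarrow> ('a, 'b) free_pl \<Rightarrow> ('a, 'b) free_pl" where
  "minus_free_pl x y = x + - y"

instance
proof
  fix a b c :: "('a, 'b) free_pl"
  show "a + b + c = a + (b + c)" by transfer (simp add: free_eq.add_assoc)
  show comm: "a + b = b + a" for a b :: "('a, 'b) free_pl" by transfer (simp add: free_eq.add_comm)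
  have "a + 0 = a" by transfer (simp add: free_eq.add_zero)
  then show "0 + a = a" by (simp add: comm)
  have "a + - a = 0" by transfer (simp add: free_eq.add_inverse)
  then show "- a + a = 0" by (simp add: comm)
qed (simp add: minus_free_pl_def)

end

lift_definition fscale :: "'k::field \<Rightarrow> ('a, 'k) free_pl \<Rightarrow> ('a, 'k) free_pl" is TScale
  by (rule free_eq.cong_scale)

lift_definition fmult :: "('a, 'k::field) free_pl \<Rightarrow> ('a, 'k) free_pl \<Rightarrow> ('a, 'k) free_pl" is TMult
  by (rule free_eq.cong_mult)

definition fgen :: "('a \<Rightarrow>\<^sub>0 'k::field) \<Rightarrow> ('a, 'k) free_pl" where
  "fgen x = abs_free_pl (Gen x)"

global_interpretation fpl: vector_space "fscale :: 'k::field \<Rightarrow> ('a, 'k) free_pl \<Rightarrow> _"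
  by unfold_locales
    (transfer, simp add: free_eq.scale_add_right free_eq.scale_add_left free_eq.scale_scale
      free_eq.scale_one)+

lemma fmult_hom_left: "module_hom fscale fscale (\<lambda>x. fmult x y)"
proof -
  have "fmult (a + b) y = fmult a y + fmult b y" for a b
    by transfer (simp add: free_eq.mult_add_left)
  moreover have "fmult (fscale c a) y = fscale c (fmult a y)" for a c
    by transfer (simp add: free_eq.mult_scale_left)
  ultimately show ?thesis by (simp add: module_hom_iff fpl.module_axioms)
qed

lemma fmult_hom_right: "module_hom fscale fscale (fmult x)"
proof -
  have "fmult x (a + b) = fmult x a + fmult x b" for a b
    by transfer (simp add: free_eq.mult_add_right)
  moreover have "fmult x (fscale c a) = fscale c (fmult x a)" for a c
    by transfer (simp add: free_eq.mult_scale_right)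
  ultimately show ?thesis by (simp add: module_hom_iff fpl.module_axioms)
qed

lemma fgen_hom: "module_hom scale fscale (fgen :: ('a \<Rightarrow>\<^sub>0 'k::field) \<Rightarrow> _)"
proof -
  have s: "vadd full_struct = (+)" "vscale full_struct = scale" "vcarrier full_struct = UNIV"
    by (simp_all add: full_struct_def)
  have "fgen (x + y) = fgen x + fgen y" for x y :: "'a \<Rightarrow>\<^sub>0 'k"
    using free_eq.gen_add[of x full_struct y]
    by (simp add: s fgen_def plus_free_pl.abs_eq free_pl.abs_eq_iff)
  moreover have "fgen (scale c x) = fscale c (fgen x)" for c and x :: "'a \<Rightarrow>\<^sub>0 'k"
    using free_eq.gen_scale[of x full_struct c]
    by (simp add: s fgen_def fscale.abs_eq free_pl.abs_eq_iff)
  ultimately show ?thesis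
    by (simp add: module_hom_iff fpl.module_axioms pm.module_axioms)
qed

lemma fmult_prelie: "fmult (fmult x y) z + fmult x (fmult z y) = fmult (fmult x z) y + fmult x (fmult y z)"
proof -
  have neg: "- u = fscale (- 1) u" for u :: "('a, 'b) free_pl"
    by transfer (simp add: free_eq.refl)
  have "fmult (fmult x y) z + fscale (- 1) (fmult x (fmult y z))
      = fmult (fmult x z) y + fscale (- 1) (fmult x (fmult z y))"
    by transfer (simp add: free_eq.prelie)
  then show ?thesis by (simp add: neg[symmetric] algebra_simps)
qed

text \<open>Functoriality of the free algebra in its generators. With \<open>g\<close> a projection
  onto a subspace, congruences over the whole space are brought back to that subspace, so computing
  in \<open>free_pl\<close> is enough.\<close>

lemma free_eq_full_imp:
  fixes g :: "('a \<Rightarrow>\<^sub>0 'k::field) \<Rightarrow> 'b"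
  assumes "linear_hom full_struct W g" and "free_eq full_struct s t"
  shows "free_eq W (map_pterm (\<lambda>c. c) g s) (map_pterm (\<lambda>c. c) g t)"
proof -
  have g: "g x \<in> vcarrier W" "g (vadd full_struct x y) = vadd W (g x) (g y)"
    "g (vscale full_struct c x) = vscale W c (g x)" for x y c
    using assms(1) by (simp_all add: linear_hom_def full_struct_def)
  have cl: "map_pterm (\<lambda>c. c) g u \<in> pterms W" for u :: "('k, 'a \<Rightarrow>\<^sub>0 'k) pterm"
    by (induction u) (simp_all add: g)
  show ?thesis using assms(2)
  proof induction
    case (sym s t) show ?case by (rule free_eq.sym) fact
  next
    case (trans s t u) show ?case by (rule free_eq.trans) fact+
  qed (simp_all add: g cl free_eq.intros(1,4-))
qed

section \<open>The inverse morphism\<close>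

text \<open>For linear \<open>f\<close> this is f \<otimes> f followed by the product of the free
  algebra.\<close>

definition fbil :: "(('d ptree \<Rightarrow>\<^sub>0 'k::field) \<Rightarrow> ('d ptree, 'k) free_pl)
    \<Rightarrow> ('d ptree \<times> 'd ptree \<Rightarrow>\<^sub>0 'k) \<Rightarrow> ('d ptree, 'k) free_pl" where
  "fbil f = lext fscale (\<lambda>p. fmult (f (single1 (fst p))) (f (single1 (snd p))))"

text \<open>The inverse of the canonical morphism in degrees up to \<open>M\<close>, so that the same polynomials
  \<open>qproj M\<close> and \<open>qrest M\<close> serve for all elements. The recursion on \<open>n\<close> is a recursion on the
  degree.\<close>

primrec inv_mor :: "nat \<Rightarrow> nat \<Rightarrow> ('d ptree \<Rightarrow>\<^sub>0 'k::field_char_0) \<Rightarrow> ('d ptree, 'k) free_pl" where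
  "inv_mor M 0 x = 0"
| "inv_mor M (Suc n) x = fgen (qproj M x) + fbil (inv_mor M n) (delta (qrest M x))"

lemma fbil_hom: "module_hom scale fscale (fbil f)"
  unfolding fbil_def by (rule fpl.module_hom_lext)

lemma fbil_tens:
  assumes "module_hom scale fscale f"
  shows "fbil f (tens x y) = fmult (f x) (f y)"
  unfolding fbil_def
  by (rule lext_tens[of fscale "\<lambda>x y. fmult (f x) (f y)"])
    (intro module_hom_comp[OF assms fmult_hom_left] module_hom_comp[OF assms fmult_hom_right])+

lemma inv_mor_hom: "module_hom scale fscale (inv_mor M n)"
proof (induction n)
  case 0
  show ?case by (simp add: module_hom_iff fpl.module_axioms pm.module_axioms)
next
  case (Suc n)
  show ?case unfolding inv_mor.simps
    by (intro module_hom_plus module_hom_comp[OF qproj_hom fgen_hom]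
        module_hom_comp[OF module_hom_comp[OF qrest_hom delta_hom] fbil_hom])
qed

text \<open>\<open>qrest\<close> keeps the degree bound and \<delta> lowers it in both factors, so
  recursion steps beyond the degree change nothing. Hence \<open>inv_mor_eq\<close> can have the
  same depth on both sides.\<close>

lemma inv_mor_stable:
  "x \<in> graded_upto D n \<Longrightarrow> n \<le> k \<Longrightarrow> inv_mor M k x = inv_mor M n x"
proof (induction n arbitrary: x k)
  case 0
  then have "x = 0" by (simp add: supported_on_def)
  then show ?case by (simp add: module_hom.zero[OF inv_mor_hom])
next
  case (Suc n)
  then obtain l where l: "k = Suc l" "n \<le> l" by (cases k) auto
  have "fbil (inv_mor M l) (delta (qrest M x)) = fbil (inv_mor M n) (delta (qrest M x))"
    unfolding fbil_def
    by (rule lext_cong[OF delta_support[OF qrest_graded_upto[OF Suc.prems(1)]]])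
      (auto simp: Suc.IH[OF _ l(2)])
  then show ?case by (simp add: l(1))
qed

lemma inv_mor_eq:
  assumes "x \<in> graded_upto D M"
  shows "inv_mor M M x = fgen (qproj M x) + fbil (inv_mor M M) (delta (qrest M x))"
  using inv_mor_stable[OF assms, of "Suc M" M] by simp

lemma inv_mor_ker:
  assumes "x \<in> ker_delta D" "x \<in> graded_upto D M"
  shows "inv_mor M M x = fgen x"
  using assms inv_mor_eq[OF assms(2)]
  by (simp add: ker_delta_eq qproj_ker qrest_ker module_hom.zero[OF fbil_hom])

text \<open>The kernel part of nu x disappears, as qproj(nu x) = nu(qproj x) = 0. For the other
  part, qrest(nu x) = nu(qrest x) = x - qproj x, and \<delta> kills qproj x.\<close>

lemma inv_mor_nu:
  assumes "x \<in> graded_upto D M"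
  shows "inv_mor M M (nu x) = fbil (inv_mor M M) (delta x)"
proof -
  have ker: "delta (qproj M x) = 0"
    using qproj_graded_upto[OF assms] by (simp add: ker_delta_eq)
  have "qproj M (nu x) = 0"
    using nu_eq_0[OF ker] by (simp add: nu_qproj)
  moreover have "delta (qrest M (nu x)) = delta x"
    using arg_cong[OF qproj_qrest[of x M], of delta] ker
    by (simp add: nu_qrest module_hom.add[OF delta_hom])
  ultimately show ?thesis
    using inv_mor_eq[OF nu_graded_upto[OF assms]] by (simp add: module_hom.zero[OF fgen_hom])
qed

text \<open>The order is lexicographic because the induction hypothesis is also needed for the
  product of x' and y \<bullet> x'', which may have full total degree; there only the left factor
  has become smaller.\<close>

lemma inv_mor_mult:
  fixes x y :: "'d ptree \<Rightarrow>\<^sub>0 'k::field_char_0"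
  assumes "x \<in> graded_upto D m" "y \<in> graded_upto D n" "m + n \<le> M"
  shows "inv_mor M M (ptree_mult x y) = fmult (inv_mor M M x) (inv_mor M M y)"
  using assms
proof (induction "(m + n, m)" arbitrary: m n x y rule: wf_induct_rule[OF wf_lex_prod[OF wf_less_than wf_less_than]])
  case 1
  define f where "f = (inv_mor M M :: _ \<Rightarrow> ('d ptree, 'k) free_pl)"
  have f_hom: "module_hom scale fscale f" unfolding f_def by (rule inv_mor_hom)
  have IH: "f (ptree_mult u v) = fmult (f u) (f v)"
    if "u \<in> graded_upto D i" "v \<in> graded_upto D j" "i + j < m + n \<or> i + j = m + n \<and> i < m"
    for u v i j
    unfolding f_def by (rule 1(1)[OF _ that(1,2)]) (use that(3) 1(4) in auto)
  have main: "f (ptree_mult (x + nu x) y) - fmult (f (x + nu x)) (f y) = 0"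
    if x: "x \<in> graded_upto D m" for x
  proof -
    note supp = delta_support[OF x]
    have xM: "x \<in> graded_upto D M" using x 1 by (auto intro: graded_upto_mono)
    have xy: "ptree_mult x y \<in> graded_upto D M"
      using mult_graded_upto[OF x 1(3)] 1(4) graded_upto_mono by blast
    define X where "X = lext scale (\<lambda>p. ptree_mult (single1 (fst p)) (ptree_mult y (single1 (snd p)))) (delta x)"
    have "nu (ptree_mult x y) = lext scale (\<lambda>p. ptree_mult (single1 (fst p)) (single1 (snd p))) (delta (ptree_mult x y))"
      by (simp add: nu_def)
    also have "\<dots> = ptree_mult x y
        + lext scale (\<lambda>p. ptree_mult (ptree_mult (single1 (fst p)) y) (single1 (snd p))
           + ptree_mult (single1 (fst p)) (ptree_mult (single1 (snd p)) y)) (delta x)"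
      by (simp add: mult_tens delta_mult[OF graded_upto_PT[OF x]] module_hom.add[OF pm_hom_lext]
        module_hom_lext_comp[OF pm_hom_lext])
    \<comment> \<open>The pre-Lie identity turns (x' \<bullet> y) \<bullet> x'' + x' \<bullet> (x''
      \<bullet> y) into (x' \<bullet> x'') \<bullet> y + x' \<bullet> (y \<bullet> x''). The same
      rewriting is done below in the free algebra, with \<open>Y\<close> in the role of
      \<open>X\<close>.\<close>
    also have "lext scale (\<lambda>p. ptree_mult (ptree_mult (single1 (fst p)) y) (single1 (snd p))
           + ptree_mult (single1 (fst p)) (ptree_mult (single1 (snd p)) y)) (delta x)
        = ptree_mult (nu x) y + X"
      unfolding ptree_mult_prelie[of "single1 _" y "single1 _"]
      by (simp add: pm.lext_add X_def nu_def module_hom_lext_comp[OF mult_hom_left])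
    finally have nu1: "f (nu (ptree_mult x y)) = f (ptree_mult x y) + f (ptree_mult (nu x) y) + f X"
      by (simp add: module_hom.add[OF f_hom])
    define Y where "Y = lext fscale (\<lambda>p. fmult (f (single1 (fst p))) (fmult (f y) (f (single1 (snd p))))) (delta x)"
    have "f (nu (ptree_mult x y)) = fbil f (delta (ptree_mult x y))"
      unfolding f_def by (rule inv_mor_nu[OF xy])
    also have "\<dots> = fmult (f x) (f y)
        + lext fscale (\<lambda>p. fmult (f (ptree_mult (single1 (fst p)) y)) (f (single1 (snd p)))
           + fmult (f (single1 (fst p))) (f (ptree_mult (single1 (snd p)) y))) (delta x)"
      by (simp add: delta_mult[OF graded_upto_PT[OF x]] module_hom.add[OF fbil_hom]
        module_hom_lext_comp[OF fbil_hom] fbil_tens[OF f_hom])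
    also have "lext fscale (\<lambda>p. fmult (f (ptree_mult (single1 (fst p)) y)) (f (single1 (snd p)))
           + fmult (f (single1 (fst p))) (f (ptree_mult (single1 (snd p)) y))) (delta x)
       = lext fscale (\<lambda>p. fmult (fmult (f (single1 (fst p))) (f (single1 (snd p)))) (f y)
           + fmult (f (single1 (fst p))) (fmult (f y) (f (single1 (snd p))))) (delta x)"
    proof (rule lext_cong[OF supp])
      fix p assume "p \<in> {(a, b). a \<in> PT D \<and> b \<in> PT D \<and> Suc (size a) + Suc (size b) \<le> m}"
      then obtain a b where p: "p = (a, b)" "a \<in> PT D" "b \<in> PT D" "Suc (size a) + Suc (size b) \<le> m"
        by auto
      have "f (ptree_mult (single1 a) y) = fmult (f (single1 a)) (f y)"
        by (rule IH[of _ "Suc (size a)" _ n]) (use p 1 in auto)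
      moreover have "f (ptree_mult (single1 b) y) = fmult (f (single1 b)) (f y)"
        by (rule IH[of _ "Suc (size b)" _ n]) (use p 1 in auto)
      ultimately show "fmult (f (ptree_mult (single1 (fst p)) y)) (f (single1 (snd p)))
           + fmult (f (single1 (fst p))) (f (ptree_mult (single1 (snd p)) y))
         = fmult (fmult (f (single1 (fst p))) (f (single1 (snd p)))) (f y)
           + fmult (f (single1 (fst p))) (fmult (f y) (f (single1 (snd p))))"
        by (simp add: p fmult_prelie)
    qed
    also have "\<dots> = fmult (fbil f (delta x)) (f y) + Y"
      by (simp add: fpl.lext_add Y_def fbil_def module_hom_lext_comp[OF fmult_hom_left])
    also have "fbil f (delta x) = f (nu x)"
      unfolding f_def by (rule inv_mor_nu[OF xM, symmetric])
    finally have "f (nu (ptree_mult x y)) = fmult (f x) (f y) + (fmult (f (nu x)) (f y) + Y)" .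
    with nu1 have "f (ptree_mult x y) + f (ptree_mult (nu x) y) + f X
        = fmult (f x) (f y) + (fmult (f (nu x)) (f y) + Y)"
      by simp
    moreover have "f X = Y"
      unfolding X_def Y_def module_hom_lext_comp[OF f_hom]
    proof (rule lext_cong[OF supp])
      fix p assume "p \<in> {(a, b). a \<in> PT D \<and> b \<in> PT D \<and> Suc (size a) + Suc (size b) \<le> m}"
      then obtain a b where p: "p = (a, b)" "a \<in> PT D" "b \<in> PT D" "Suc (size a) + Suc (size b) \<le> m"
        by auto
      have "f (ptree_mult y (single1 b)) = fmult (f y) (f (single1 b))"
        by (rule IH[of _ n _ "Suc (size b)"]) (use p 1 in auto)
      \<comment> \<open>The bounds may add up to exactly m + n here, so it is the second component
        of the order that decreases.\<close>
      moreover have "f (ptree_mult (single1 a) (ptree_mult y (single1 b)))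
          = fmult (f (single1 a)) (f (ptree_mult y (single1 b)))"
        by (rule IH[OF _ mult_graded_upto[OF 1(3), of _ "Suc (size b)"], of _ "Suc (size a)"])
          (use p in auto)
      ultimately show "f (ptree_mult (single1 (fst p)) (ptree_mult y (single1 (snd p))))
          = fmult (f (single1 (fst p))) (fmult (f y) (f (single1 (snd p))))"
        by (simp add: p)
    qed
    ultimately show ?thesis
      by (simp add: module_hom.add[OF f_hom] module_hom.add[OF mult_hom_left]
          module_hom.add[OF fmult_hom_left])
  qed
  have "f (ptree_mult x y) - fmult (f x) (f y) = 0"
  proof (rule vanish_of_one_plus_nu[where L = "\<lambda>x. f (ptree_mult x y) - fmult (f x) (f y)"
        and V = "graded_upto D m"])
    show "module_hom scale fscale (\<lambda>x. f (ptree_mult x y) - fmult (f x) (f y))"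
      by (intro module_hom_minus module_hom_comp[OF mult_hom_left f_hom]
          module_hom_comp[OF f_hom fmult_hom_left])
  qed (use main 1 in \<open>auto intro: subspace_supported_on nu_graded_upto graded_upto_fil\<close>)
  then show ?case by (simp add: f_def)
qed


section \<open>Freeness of the algebra of trees over the kernel\<close>

lemma prelie_algebra_g_PT: "prelie_algebra (g_PT D :: ('k::field, 'd ptree \<Rightarrow>\<^sub>0 'k) prelie_struct)"
proof -
  have carrier: "vcarrier (g_PT D) = (supported_on (PT D) :: ('d ptree \<Rightarrow>\<^sub>0 'k) set)"
    by (simp add: g_PT_def supported_on_def)
  have ops: "vzero (g_PT D) = (0 :: 'd ptree \<Rightarrow>\<^sub>0 'k)" "vadd (g_PT D) = (+)"
    "vscale (g_PT D) = (scale :: 'k \<Rightarrow> ('d ptree \<Rightarrow>\<^sub>0 'k) \<Rightarrow> _)"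
    "pmult (g_PT D) = (ptree_mult :: ('d ptree \<Rightarrow>\<^sub>0 'k) \<Rightarrow> _)"
    by (simp_all add: g_PT_def)
  note sub = subspace_supported_on[of "PT D"]
  have closed: "ptree_mult x y \<in> supported_on (PT D)"
    if "x \<in> supported_on (PT D)" "y \<in> supported_on (PT D)" for x y :: "'d ptree \<Rightarrow>\<^sub>0 'k"
    using graded_upto_exists[OF that(1)] graded_upto_exists[OF that(2)]
      mult_graded_upto graded_upto_PT by metis
  have prelie: "ptree_mult (ptree_mult x y) z - ptree_mult x (ptree_mult y z)
      = ptree_mult (ptree_mult x z) y - ptree_mult x (ptree_mult z y)"
    for x y z :: "'d ptree \<Rightarrow>\<^sub>0 'k"
    using ptree_mult_prelie[of x y z] by (simp add: algebra_simps)
  show ?thesis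
    by unfold_locales
      (simp_all add: carrier ops closed prelie add_ac pm.subspace_0[OF sub]
        pm.subspace_add[OF sub] pm.subspace_scale[OF sub] pm.scale_right_distrib
        pm.scale_left_distrib module_hom.add[OF mult_hom_left] module_hom.add[OF mult_hom_right]
        module_hom.scale[OF mult_hom_left] module_hom.scale[OF mult_hom_right])
qed

text \<open>The identity of \<open>W\<close> extends linearly to the whole space. This supplies the
  map for \<open>free_eq_full_imp\<close>.\<close>

lemma linear_projection_exists:
  fixes W :: "('a \<Rightarrow>\<^sub>0 'k::field) set"
  assumes "pm.subspace W"
  obtains g where "module_hom scale scale g" "\<And>x. g x \<in> W" "\<And>w. w \<in> W \<Longrightarrow> g w = w"
proof -
  interpret vector_space_pair "scale :: 'k \<Rightarrow> ('a \<Rightarrow>\<^sub>0 'k) \<Rightarrow> _" "scale :: 'k \<Rightarrow> ('a \<Rightarrow>\<^sub>0 'k) \<Rightarrow> _"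
    by unfold_locales
  obtain g where g: "range g \<subseteq> W" "Vector_Spaces.linear scale scale g" "\<forall>v\<in>W. g (id v) = v"
    using linear_exists_left_inverse_on[OF pm.linear_id assms] by auto
  show thesis
    by (rule that[of g]) (use g in \<open>auto simp: linear_iff_module_hom\<close>)
qed

context
  fixes D :: "'d set" and A :: "('k::field_char_0, 'd ptree \<Rightarrow>\<^sub>0 'k) prelie_struct"
    and W :: "('k, 'd ptree \<Rightarrow>\<^sub>0 'k) vec_struct"
  defines "A \<equiv> g_PT D" and "W \<equiv> subspace_struct A (ker_delta D)"
begin

lemma A_simps:
  "vcarrier A = supported_on (PT D)" "vzero A = 0" "vadd A = (+)" "vscale A = scale"
  "pmult A = ptree_mult"
  by (simp_all add: A_def g_PT_def supported_on_def)

lemma W_simps: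
  "vcarrier W = ker_delta D" "vzero W = 0" "vadd W = (+)" "vscale W = scale"
  by (simp_all add: W_def subspace_struct_def A_simps)

lemma vec_space_W: "vec_space W"
  using subspace_ker_delta[of D]
  by unfold_locales
    (auto simp: W_simps add_ac pm.scale_right_distrib pm.scale_left_distrib
      intro: pm.subspace_0 pm.subspace_add pm.subspace_scale)

lemma linear_hom_W_A: "linear_hom W A (\<lambda>w. w)"
  by (simp add: linear_hom_def W_simps A_simps ker_delta_eq)

text \<open>Makes \<open>inv_mor\<close> a left inverse of evaluation. The bound depends on the
  term; for a product it is the sum of the two bounds, as \<open>inv_mor_mult\<close>
  demands.\<close>

lemma inv_mor_eval:
  assumes "s \<in> pterms W"
  shows "\<exists>m. pterm_eval A (\<lambda>w. w) s \<in> graded_upto D m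
    \<and> (\<forall>M\<ge>m. inv_mor M M (pterm_eval A (\<lambda>w. w) s) = abs_free_pl s)"
  using assms
proof (induction s)
  case (Gen x)
  then have x: "x \<in> ker_delta D" by (simp add: W_simps)
  then have "x \<in> supported_on (PT D)" by (simp add: ker_delta_eq)
  then obtain m where "x \<in> graded_upto D m" by (rule graded_upto_exists)
  then show ?case
    using inv_mor_ker[OF x] by (intro exI[of _ m]) (auto simp: fgen_def intro: graded_upto_mono)
next
  case TZero
  show ?case
    by (auto simp: A_simps module_hom.zero[OF inv_mor_hom] zero_free_pl_def
        pm.subspace_0[OF subspace_supported_on])
next
  case (TAdd s t)
  then obtain m n where m: "pterm_eval A (\<lambda>w. w) s \<in> graded_upto D m"
      "\<forall>M\<ge>m. inv_mor M M (pterm_eval A (\<lambda>w. w) s) = abs_free_pl s"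
    and n: "pterm_eval A (\<lambda>w. w) t \<in> graded_upto D n"
      "\<forall>M\<ge>n. inv_mor M M (pterm_eval A (\<lambda>w. w) t) = abs_free_pl t"
    by auto
  have "pterm_eval A (\<lambda>w. w) s + pterm_eval A (\<lambda>w. w) t \<in> graded_upto D (m + n)"
    by (intro pm.subspace_add subspace_supported_on graded_upto_mono[OF m(1)] graded_upto_mono[OF n(1)]) auto
  then show ?case
    using m(2) n(2)
    by (intro exI[of _ "m + n"]) (simp add: A_simps module_hom.add[OF inv_mor_hom] plus_free_pl.abs_eq)
next
  case (TScale c t)
  then obtain m where "pterm_eval A (\<lambda>w. w) t \<in> graded_upto D m"
      "\<forall>M\<ge>m. inv_mor M M (pterm_eval A (\<lambda>w. w) t) = abs_free_pl t"
    by auto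
  then show ?case
    by (intro exI[of _ m]) (simp add: A_simps module_hom.scale[OF inv_mor_hom] fscale.abs_eq
      pm.subspace_scale subspace_supported_on)
next
  case (TMult s t)
  then obtain m n where m: "pterm_eval A (\<lambda>w. w) s \<in> graded_upto D m"
      "\<forall>M\<ge>m. inv_mor M M (pterm_eval A (\<lambda>w. w) s) = abs_free_pl s"
    and n: "pterm_eval A (\<lambda>w. w) t \<in> graded_upto D n"
      "\<forall>M\<ge>n. inv_mor M M (pterm_eval A (\<lambda>w. w) t) = abs_free_pl t"
    by auto
  show ?case
    using m(2) n(2) mult_graded_upto[OF m(1) n(1)]
    by (intro exI[of _ "m + n"]) (simp add: A_simps inv_mor_mult[OF m(1) n(1)] fmult.abs_eq)
qed

text \<open>Injectivity. One \<open>M\<close> large enough for both terms shows that they have the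
  same class in \<open>free_pl\<close>, so they are congruent over the whole space. The projection
  \<open>g\<close> fixes their generators and carries this congruence to \<open>W\<close>.\<close>

lemma free_eq_of_eval_eq:
  assumes "s \<in> pterms W" "t \<in> pterms W"
    and "pterm_eval A (\<lambda>w. w) s = pterm_eval A (\<lambda>w. w) t"
  shows "free_eq W s t"
proof -
  obtain m n where "\<forall>M\<ge>m. inv_mor M M (pterm_eval A (\<lambda>w. w) s) = abs_free_pl s"
    "\<forall>M\<ge>n. inv_mor M M (pterm_eval A (\<lambda>w. w) t) = abs_free_pl t"
    using inv_mor_eval assms(1,2) by blast
  then have "abs_free_pl s = abs_free_pl t"
    using assms(3) by (metis le_add1 le_add2)
  then have eq: "free_eq full_struct s t"
    by (simp add: free_pl.abs_eq_iff)
  obtain g :: "('d ptree \<Rightarrow>\<^sub>0 'k) \<Rightarrow> 'd ptree \<Rightarrow>\<^sub>0 'k"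
    where g: "module_hom scale scale g" "\<And>x. g x \<in> ker_delta D"
    "\<And>w. w \<in> ker_delta D \<Longrightarrow> g w = w"
    using linear_projection_exists[OF subspace_ker_delta[of D]] by metis
  have "linear_hom full_struct W g"
    by (simp add: linear_hom_def full_struct_def W_simps g(2) module_hom.add[OF g(1)]
        module_hom.scale[OF g(1)])
  then have "free_eq W (map_pterm (\<lambda>c. c) g s) (map_pterm (\<lambda>c. c) g t)"
    using eq by (rule free_eq_full_imp)
  moreover have "map_pterm (\<lambda>c. c) g u = u" if "u \<in> pterms W" for u :: "('k, 'd ptree \<Rightarrow>\<^sub>0 'k) pterm"
    using that by (induction u) (simp_all add: W_simps g(3))
  ultimately show ?thesis using assms by simp
qed

text \<open>The values of terms form a subspace that contains the kernel and is closed under the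
  product, so \<open>ker_delta_generates\<close> applies.\<close>

lemma eval_surj:
  assumes "x \<in> supported_on (PT D)"
  shows "x \<in> pterm_eval A (\<lambda>w. w) ` pterms W"
proof -
  let ?V = "pterm_eval A (\<lambda>w. w) ` pterms W"
  have "pm.subspace ?V"
    unfolding pm.subspace_def
  proof (intro conjI ballI allI)
    show "0 \<in> ?V" by (rule image_eqI[of _ _ TZero]) (simp_all add: A_simps)
  next
    fix x y :: "'d ptree \<Rightarrow>\<^sub>0 'k" assume "x \<in> ?V" "y \<in> ?V"
    then obtain s t where "x = pterm_eval A (\<lambda>w. w) s" "y = pterm_eval A (\<lambda>w. w) t" "s \<in> pterms W" "t \<in> pterms W"
      by auto
    then show "x + y \<in> ?V" by (intro image_eqI[of _ _ "TAdd s t"]) (simp_all add: A_simps)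
  next
    fix c and x :: "'d ptree \<Rightarrow>\<^sub>0 'k" assume "x \<in> ?V"
    then obtain s where "x = pterm_eval A (\<lambda>w. w) s" "s \<in> pterms W" by auto
    then show "scale c x \<in> ?V" by (intro image_eqI[of _ _ "TScale c s"]) (simp_all add: A_simps)
  qed
  moreover have "ker_delta D \<subseteq> ?V"
  proof
    fix x :: "'d ptree \<Rightarrow>\<^sub>0 'k" assume "x \<in> ker_delta D"
    then show "x \<in> ?V" by (intro image_eqI[of _ _ "Gen x"]) (simp_all add: W_simps)
  qed
  moreover have "ptree_mult x y \<in> ?V" if xy: "x \<in> ?V" "y \<in> ?V" for x y :: "'d ptree \<Rightarrow>\<^sub>0 'k"
  proof -
    obtain s t where "x = pterm_eval A (\<lambda>w. w) s" "y = pterm_eval A (\<lambda>w. w) t" "s \<in> pterms W" "t \<in> pterms W"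
      using xy by auto
    then show ?thesis by (intro image_eqI[of _ _ "TMult s t"]) (simp_all add: A_simps)
  qed
  ultimately have "supported_on (PT D) \<subseteq> ?V" by (rule ker_delta_generates)
  with assms show ?thesis by blast
qed

lemma prelie_iso_free_lift: "prelie_iso (free_prelie W) A (free_lift A (\<lambda>w. w))"
proof -
  have alg: "prelie_algebra A" unfolding A_def by (rule prelie_algebra_g_PT)
  note lift = free_lift_class[OF vec_space_W alg linear_hom_W_A]
  have "inj_on (free_lift A (\<lambda>w. w)) (vcarrier (free_prelie W))"
    by (auto simp: inj_on_def free_prelie_simps lift intro!: free_class_eqI free_eq_of_eval_eq)
  moreover have "free_lift A (\<lambda>w. w) ` vcarrier (free_prelie W) = vcarrier A"
    using eval_surj pterm_eval_closed[OF alg linear_hom_W_A]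
    by (auto simp: free_prelie_simps lift A_simps image_image cong: image_cong_simp)
  ultimately show ?thesis
    unfolding prelie_iso_def bij_betw_def
    using free_prelie_universal(2)[OF vec_space_W alg linear_hom_W_A] by blast
qed

lemma vec_subspace_ker_delta: "vec_subspace (ker_delta D) A"
  using subspace_ker_delta[of D]
  by (auto simp: vec_subspace_def A_simps pm.subspace_def ker_delta_eq)

end

theorem corollary40:
  fixes D :: "'d set"
  shows "freely_generated_by
    (g_PT D :: ('k::field_char_0, 'd ptree \<Rightarrow>\<^sub>0 'k) prelie_struct) (ker_delta D)"
  unfolding freely_generated_by_def
  using prelie_algebra_g_PT vec_subspace_ker_delta prelie_iso_free_lift by blast

end
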